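(* Let $\mu$ be a probability measure on $\mathbb{R}$ such that $m_1(\mu)=0$, $m_2(\mu)=1$ and $m_6(\mu)<\infty$. For each positive integer $n$ define $\mu_n:=D_{\frac{1}{\sqrt{n}}}\mu^{\uplus n}$. Then there is a constant $C$ depending only on $\mu$ such that for all sufficiently large $n$, $$d_{lev}(\mu_n,\mathbf{b})\leq \frac{7}{2}\,\frac{C+2}{\sqrt{n}},$$ where $\mathbf{b}=\frac{1}{2}\delta_{-1}+\frac{1}{2}\delta_{1}$ is the symmetric Bernoulli distribution.
   Context: $m_k(\mu)=\int t^k\,d\mu(t)$ denotes the $k$-th moment. For a non-negative Borel measure $\mu$ on $\mathbb{R}$, its Cauchy transform is $G_\mu(z)=\int_{\mathbb{R}}\frac{1}{z-t}\,d\mu(t)$ for $z$ in the open upper half-plane $\mathbb{C}^+$, and its reciprocal Cauchy transform is $F_\mu(z)=1/G_\mu(z)$. The Boolean convolution $\mu\uplus\nu$ of probability measures $\mu,\nu$ is the probability measure determined by $F_{\mu\uplus\nu}(z)=F_\mu(z)+F_\nu(z)-z$ for $z\in\mathbb{C}^+$, and $\mu^{\uplus n}$ is the $n$-fold Boolean convolution of $\mu$ with itself. For $a>0$, the dilation $D_a\mu$ is defined by $D_a\mu(B)=\mu(a^{-1}B)$ for Borel sets $B$. The Lévy distance between probability measures $\mu,\nu$ with distribution functions $F,G$ is $d_{lev}(\mu,\nu)=\inf\{\epsilon>0: F(x-\epsilon)-\epsilon\le G(x)\le F(x+\epsilon)+\epsilon \text{ for all } x\in\mathbb{R}\}$. 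*)

theory Defs
  imports "HOL-Probability.Probability"
begin

definition moment :: "nat \<Rightarrow> real measure \<Rightarrow> real" where
  "moment k \<mu> = (\<integral>t. t ^ k \<partial>\<mu>)"

definition cauchy_transform :: "real measure \<Rightarrow> complex \<Rightarrow> complex" where
  "cauchy_transform \<mu> z = (\<integral>t. 1 / (z - complex_of_real t) \<partial>\<mu>)"

definition recip_cauchy :: "real measure \<Rightarrow> complex \<Rightarrow> complex" where
  "recip_cauchy \<mu> z = 1 / cauchy_transform \<mu> z"

definition boolean_conv :: "real measure \<Rightarrow> real measure \<Rightarrow> real measure" where
  "boolean_conv \<mu> \<nu> = (THE \<rho>. real_distribution \<rho> \<and>
      (\<forall>z. 0 < Im z \<longrightarrow> recip_cauchy \<rho> z = recip_cauchy \<mu> z + recip_cauchy \<nu> z - z))"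

text \<open>n-fold Boolean convolution power (for n \<ge> 1; the value at 0 is an irrelevant convention).\<close>

fun boolean_pow :: "real measure \<Rightarrow> nat \<Rightarrow> real measure" where
  "boolean_pow \<mu> 0 = \<mu>"
| "boolean_pow \<mu> (Suc 0) = \<mu>"
| "boolean_pow \<mu> (Suc (Suc n)) = boolean_conv (boolean_pow \<mu> (Suc n)) \<mu>"

definition dilation :: "real \<Rightarrow> real measure \<Rightarrow> real measure" where
  "dilation a \<mu> = distr \<mu> borel (\<lambda>x. a * x)"

definition cdf_of :: "real measure \<Rightarrow> real \<Rightarrow> real" where
  "cdf_of \<mu> x = measure \<mu> {..x}"

definition levy_dist :: "real measure \<Rightarrow> real measure \<Rightarrow> real" where
  "levy_dist \<mu> \<nu> = Inf {\<epsilon>. 0 < \<epsilon> \<and> (\<forall>x. cdf_of \<mu> (x - \<epsilon>) - \<epsilon> \<le> cdf_of \<nu> x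
                                          \<and> cdf_of \<nu> x \<le> cdf_of \<mu> (x + \<epsilon>) + \<epsilon>)}"

definition sym_bernoulli :: "real measure" where
  "sym_bernoulli = distr (measure_pmf (pmf_of_set {-1, 1})) borel (\<lambda>x. x)"

end

theory Submission
  imports Defs "HOL-Computational_Algebra.Fundamental_Theorem_Algebra"
begin

text \<open>
  Put \<open>X = Y / sqrt n\<close> with \<open>Y\<close> distributed as the n-th Boolean power of \<open>\<mu>\<close>. Up to order six the
  moments of \<open>X\<close> are explicit, and with \<open>b = m\<^sub>3 / sqrt n\<close> they give
  \<open>E (X\<^sup>2 - 1)\<^sup>2 = O(1/n)\<close>, \<open>E (X\<^sup>2 (X\<^sup>2 - 1 - b X)\<^sup>2) = O(1/n\<^sup>2)\<close> and \<open>E (X \<plusminus> 1)\<^sup>2 = 2\<close>.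
  Markov's inequality applied to the first two shows that \<open>X\<close> lies within \<open>O(1 / sqrt n)\<close> of
  \<open>\<plusminus>1\<close> outside an event of probability \<open>O(1/n)\<close>; applied to the third it shows that each of the
  two neighbourhoods has mass at most \<open>1/2 + O(1 / sqrt n)\<close>.

  Boolean powers exist for finitely supported laws, because \<open>1 / (n F - (n - 1) z)\<close> is then a rational
  function with real simple poles and positive residues. In general one approximates \<open>\<mu>\<close> by finitely
  supported laws and extracts a weak limit by Helly's theorem. Only upper bounds for means of nonnegative
  polynomials have to survive the limit. Stieltjes inversion gives uniqueness.
\<close>

section \<open>Boolean powers of finitely supported laws\<close>

text \<open>The variance about the mean \<open>m\<close> is nonnegative. This and its normed version
  are the Cauchy-Schwarz inequalities that later force the zeros of \<open>R\<close> to be real and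
  the residues to be positive.\<close>

lemma weighted_mean_square_le:
  fixes w f :: "'a \<Rightarrow> real"
  assumes "finite S" "\<And>x. x \<in> S \<Longrightarrow> 0 \<le> w x" "sum w S = 1"
  shows "(\<Sum>x\<in>S. w x * f x)\<^sup>2 \<le> (\<Sum>x\<in>S. w x * (f x)\<^sup>2)"
proof -
  define m where "m = (\<Sum>x\<in>S. w x * f x)"
  have "0 \<le> (\<Sum>x\<in>S. w x * (f x - m)\<^sup>2)"
    using assms by (intro sum_nonneg) auto
  also have "\<dots> = (\<Sum>x\<in>S. w x * (f x)\<^sup>2 - 2 * m * (w x * f x) + m\<^sup>2 * w x)"
    by (intro sum.cong) (auto simp: power2_eq_square algebra_simps)
  also have "\<dots> = (\<Sum>x\<in>S. w x * (f x)\<^sup>2) - 2 * m * m + m\<^sup>2"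
    using assms(3) by (simp add: sum.distrib sum_subtractf sum_distrib_left[symmetric] m_def)
  finally show ?thesis by (simp add: m_def power2_eq_square)
qed

lemma norm_weighted_mean_square_le:
  fixes w :: "'a \<Rightarrow> real" and f :: "'a \<Rightarrow> 'b::real_normed_vector"
  assumes "finite S" "\<And>x. x \<in> S \<Longrightarrow> 0 \<le> w x" "sum w S = 1"
  shows "(norm (\<Sum>x\<in>S. w x *\<^sub>R f x))\<^sup>2 \<le> (\<Sum>x\<in>S. w x * (norm (f x))\<^sup>2)"
proof -
  have "norm (\<Sum>x\<in>S. w x *\<^sub>R f x) \<le> (\<Sum>x\<in>S. w x * norm (f x))"
    using assms(2) by (intro sum_norm_le) auto
  then have "(norm (\<Sum>x\<in>S. w x *\<^sub>R f x))\<^sup>2 \<le> (\<Sum>x\<in>S. w x * norm (f x))\<^sup>2"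
    by (intro power_mono) auto
  also have "\<dots> \<le> (\<Sum>x\<in>S. w x * (norm (f x))\<^sup>2)"
    by (rule weighted_mean_square_le) (use assms in auto)
  finally show ?thesis .
qed

lemma pderiv_sum: "pderiv (sum f A) = (\<Sum>x\<in>A. pderiv (f x))"
  by (induction A rule: infinite_finite_induct) (auto simp: pderiv_add)

text \<open>Both sides have degree below \<open>card T\<close> and agree on \<open>T\<close>: at a
  node only its own summand survives, and the derivative of \<open>R\<close> there is the product of
  the differences to the other nodes. Division by \<open>R\<close> gives the partial fractions of
  \<open>Q / R\<close>.\<close>

lemma lagrange_partial_fractions:
  fixes Q :: "'a::field_char_0 poly"
  assumes T: "finite T" and R: "R = (\<Prod>s\<in>T. [:-s, 1:])" and deg: "degree Q < card T"
  shows "Q = (\<Sum>r\<in>T. smult (poly Q r / poly (pderiv R) r) (\<Prod>s\<in>T - {r}. [:-s, 1:]))"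
proof (rule poly_eqI_degree[where A = T])
  have pd: "poly (pderiv R) r = (\<Prod>s\<in>T - {r}. r - s)" if "r \<in> T" for r
  proof -
    have "R = [:-r, 1:] * (\<Prod>s\<in>T - {r}. [:-s, 1:])"
      unfolding R using T that by (simp add: prod.remove)
    then show ?thesis
      by (simp only: pderiv_mult poly_add poly_mult) (simp add: poly_prod pderiv_pCons)
  qed
  show "poly Q x = poly (\<Sum>r\<in>T. smult (poly Q r / poly (pderiv R) r) (\<Prod>s\<in>T - {r}. [:-s, 1:])) x"
    if x: "x \<in> T" for x
  proof -
    have "poly (\<Sum>r\<in>T. smult (poly Q r / poly (pderiv R) r) (\<Prod>s\<in>T - {r}. [:-s, 1:])) x
       = (\<Sum>r\<in>T. if r = x then poly Q x else 0)"
      unfolding poly_sum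
    proof (intro sum.cong refl)
      fix r assume r: "r \<in> T"
      show "poly (smult (poly Q r / poly (pderiv R) r) (\<Prod>s\<in>T - {r}. [:-s, 1:])) x
          = (if r = x then poly Q x else 0)"
        using T r x by (auto simp: poly_prod pd)
    qed
    also have "\<dots> = poly Q x" using T x by simp
    finally show ?thesis by simp
  qed
  show "degree Q < card T" by fact
  have "degree (smult (poly Q r / poly (pderiv R) r) (\<Prod>s\<in>T - {r}. [:-s, 1:])) \<le> card T - 1"
    if "r \<in> T" for r
  proof -
    have "degree (\<Prod>s\<in>T - {r}. [:-s, 1:]) = (\<Sum>s\<in>T - {r}. degree [:-s, 1:])"
      by (rule degree_prod_eq_sum_degree) auto
    also have "\<dots> = card T - 1" using T that by simp
    finally show ?thesis by (metis degree_smult_le)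
  qed
  then have "degree (\<Sum>r\<in>T. smult (poly Q r / poly (pderiv R) r) (\<Prod>s\<in>T - {r}. [:-s, 1:])) \<le> card T - 1"
    by (intro degree_sum_le T) auto
  then show "degree (\<Sum>r\<in>T. smult (poly Q r / poly (pderiv R) r) (\<Prod>s\<in>T - {r}. [:-s, 1:])) < card T"
    using deg by linarith
qed

text \<open>If \<open>G\<close> is the transform of the given law, the law sought has transform
  \<open>1 / (n / G - (n - 1) z)\<close>; the conclusion is this equation cleared of the divisions
  by \<open>G\<close>, so zeros of \<open>G\<close> need no exception. With \<open>G = Q / P\<close>
  the new transform is \<open>Q / R\<close>, where \<open>R = n P - (n - 1) z Q\<close>, and its
  partial fractions give the atoms \<open>T\<close> and weights \<open>p\<close>.\<close>

lemma finite_boolean_power: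
  fixes S :: "real set" and w :: "real \<Rightarrow> real" and n :: nat
  assumes S: "finite S" and w: "\<And>x. x \<in> S \<Longrightarrow> 0 < w x" and w1: "sum w S = 1" and n: "n \<ge> 1"
  obtains T :: "real set" and p :: "real \<Rightarrow> real" where "finite T" "\<And>r. r \<in> T \<Longrightarrow> 0 < p r"
    "\<And>z::complex. z \<notin> of_real ` S \<Longrightarrow> z \<notin> of_real ` T \<Longrightarrow>
       (\<Sum>r\<in>T. p r / (z - r)) * (n - (real n - 1) * (z * (\<Sum>x\<in>S. w x / (z - x)))) = (\<Sum>x\<in>S. w x / (z - x))"
proof -
  define lin where "lin x = [:- complex_of_real x, 1:]" for x
  define P where "P = prod lin S"
  define Px where "Px x = prod lin (S - {x})" for x
  define Q where "Q = (\<Sum>x\<in>S. smult (of_real (w x)) (Px x))"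
  define R where "R = smult (of_nat n) P - smult (of_real (real n - 1)) ([:0, 1:] * Q)"
  have Pf: "P = lin x * Px x" if "x \<in> S" for x
    unfolding P_def Px_def using S that by (simp add: prod.remove)
  have Px0: "poly (Px x) y = (\<Prod>s\<in>S - {x}. y - of_real s)" for x y
    by (simp add: Px_def lin_def poly_prod)
  have Q0: "poly Q z = (\<Sum>x\<in>S. w x *\<^sub>R poly (Px x) z)" for z
    by (simp add: Q_def poly_sum scaleR_conv_of_real)
  have S0: "S \<noteq> {}" using w1 by auto
  have degPx: "degree (Px x) = card S - 1" "coeff (Px x) (card S - 1) = 1" if "x \<in> S" for x
  proof -
    have "degree (Px x) = (\<Sum>y\<in>S - {x}. degree (lin y))"
      unfolding Px_def by (rule degree_prod_eq_sum_degree) (auto simp: lin_def)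
    then show *: "degree (Px x) = card S - 1"
      using S that by (simp add: lin_def)
    have "lead_coeff (Px x) = 1" by (simp add: Px_def lead_coeff_prod lin_def)
    then show "coeff (Px x) (card S - 1) = 1" using * by simp
  qed
  have degP: "degree P = card S" "lead_coeff P = 1"
  proof -
    have "degree P = (\<Sum>y\<in>S. degree (lin y))"
      unfolding P_def by (rule degree_prod_eq_sum_degree) (auto simp: lin_def)
    then show "degree P = card S" by (simp add: lin_def)
    show "lead_coeff P = 1" by (simp add: P_def lead_coeff_prod lin_def)
  qed
  have cS: "card S > 0" using S S0 by (simp add: card_gt_0_iff)
  have degQ: "degree Q \<le> card S - 1"
    unfolding Q_def by (intro degree_sum_le S) (metis degree_smult_le degPx(1))
  have coQ: "coeff Q (card S - 1) = 1"
  proof -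
    have "coeff Q (card S - 1) = (\<Sum>x\<in>S. of_real (w x))"
      unfolding Q_def coeff_sum by (intro sum.cong) (auto simp del: One_nat_def simp: degPx)
    then show ?thesis using w1 by (simp flip: of_real_sum)
  qed
  \<comment> \<open>\<open>P\<close> and \<open>z Q\<close> are both monic of degree
    \<open>card S\<close>, the latter because the weights sum to 1; so the top coefficient of
    \<open>R\<close> is \<open>n - (n - 1)\<close>.\<close>
  have coR: "coeff R (card S) = 1"
    using degP coQ cS by (cases "card S") (auto simp: R_def)
  have degR: "degree R = card S"
  proof (rule antisym)
    have "degree ([:0, 1:] * Q) \<le> card S"
      using degQ cS by (intro order_trans[OF degree_mult_le]) auto
    then show "degree R \<le> card S"
      unfolding R_def by (intro degree_diff_le order_trans[OF degree_smult_le]) (auto simp: degP)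
    show "card S \<le> degree R" using coR by (intro le_degree) auto
  qed
  have Rlead: "lead_coeff R = 1" using degR coR by simp
  have R0: "R \<noteq> 0" using Rlead by auto

  \<comment> \<open>At an atom \<open>x\<close> all \<open>Px y\<close> with
    \<open>y \<noteq> x\<close> vanish, so only the nonzero summand of \<open>x\<close> is
    left.\<close>
  have noPQ: "poly Q z \<noteq> 0" if z: "poly P z = 0" for z
  proof -
    obtain x where x: "x \<in> S" "z = of_real x"
      using z S by (auto simp: P_def lin_def poly_prod)
    have "poly Q z = (\<Sum>y\<in>S. if y = x then w x *\<^sub>R poly (Px x) z else 0)"
      unfolding Q0 using x S by (intro sum.cong) (auto simp: Px0)
    also have "\<dots> = w x *\<^sub>R poly (Px x) z" using x S by simp
    also have "\<dots> \<noteq> 0" using w[of x] x S by (auto simp: Px0)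
    finally show ?thesis .
  qed

  \<comment> \<open>By Cauchy--Schwarz, \<open>Im (R * cnj Q) / Im z \<ge> \<bar>Q\<bar>\<^sup>2\<close>, so all zeros of R are real.\<close>
  have PcQ: "poly P z * cnj (poly Q z) = (\<Sum>x\<in>S. (w x * (norm (poly (Px x) z))\<^sup>2) *\<^sub>R (z - of_real x))" for z
  proof -
    have "poly P z * cnj (poly Q z) = (\<Sum>x\<in>S. w x *\<^sub>R (poly P z * cnj (poly (Px x) z)))"
      by (simp add: Q0 sum_distrib_left scaleR_conv_of_real mult_ac)
    also have "\<dots> = (\<Sum>x\<in>S. (w x * (norm (poly (Px x) z))\<^sup>2) *\<^sub>R (z - of_real x))"
    proof (intro sum.cong refl)
      fix x assume "x \<in> S"
      have "poly P z = (z - of_real x) * poly (Px x) z"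
        by (subst Pf[OF \<open>x \<in> S\<close>]) (simp add: lin_def algebra_simps)
      then show "w x *\<^sub>R (poly P z * cnj (poly (Px x) z)) = (w x * (norm (poly (Px x) z))\<^sup>2) *\<^sub>R (z - of_real x)"
        by (simp add: scaleR_conv_of_real mult_ac complex_norm_square flip: of_real_power)
    qed
    finally show ?thesis .
  qed
  have ImR: "Im (poly R z * cnj (poly Q z)) = Im z * (n * (\<Sum>x\<in>S. w x * (norm (poly (Px x) z))\<^sup>2) - (real n - 1) * (norm (poly Q z))\<^sup>2)" for z
  proof -
    have "poly R z * cnj (poly Q z) = of_nat n * (poly P z * cnj (poly Q z)) - of_real (real n - 1) * (z * (poly Q z * cnj (poly Q z)))"
      by (simp add: R_def algebra_simps)
    also have "\<dots> = of_nat n * (poly P z * cnj (poly Q z)) - of_real ((real n - 1) * (norm (poly Q z))\<^sup>2) * z"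
      by (simp only: complex_norm_square[symmetric] of_real_mult mult_ac)
    also have "Im \<dots> = n * Im (poly P z * cnj (poly Q z)) - (real n - 1) * (norm (poly Q z))\<^sup>2 * Im z"
      by simp
    also have "Im (poly P z * cnj (poly Q z)) = Im z * (\<Sum>x\<in>S. w x * (norm (poly (Px x) z))\<^sup>2)"
      unfolding PcQ by (simp add: sum_distrib_left mult_ac)
    finally show ?thesis by (simp add: algebra_simps)
  qed
  have Qneg: "(norm (poly Q z))\<^sup>2 \<le> (\<Sum>x\<in>S. w x * (norm (poly (Px x) z))\<^sup>2)" for z
    unfolding Q0 by (rule norm_weighted_mean_square_le) (use S w w1 in \<open>auto intro: less_imp_le\<close>)
  have Qroot: "poly Q z \<noteq> 0" if "poly R z = 0" for z
  proof
    assume "poly Q z = 0"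
    then have "poly P z = 0" using that n by (simp add: R_def)
    then show False using noPQ \<open>poly Q z = 0\<close> by blast
  qed
  \<comment> \<open>The left side is \<open>q + n * (s - q)\<close>. It serves both the imaginary
    part and the Wronskian.\<close>
  have key: "real n * s - (real n - 1) * q \<ge> q" if "q \<le> s" for s q :: real
  proof -
    have "real n * q \<le> real n * s" using that by (intro mult_left_mono) auto
    then show ?thesis by (simp add: algebra_simps)
  qed
  have real_root: "Im z = 0" if "poly R z = 0" for z
  proof -
    have "0 < (norm (poly Q z))\<^sup>2" using Qroot[OF that] by simp
    also have "\<dots> \<le> n * (\<Sum>x\<in>S. w x * (norm (poly (Px x) z))\<^sup>2) - (real n - 1) * (norm (poly Q z))\<^sup>2"
      by (rule key) (rule Qneg)
    finally show ?thesis using ImR[of z] that by simp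
  qed

  \<comment> \<open>On the real line the Wronskian satisfies \<open>R' Q - R Q' \<ge> Q\<^sup>2\<close>, again by Cauchy--Schwarz;
    hence the zeros of R are simple and the residues \<open>Q / R'\<close> are positive.\<close>
  have wronski: "pderiv P * Q - P * pderiv Q = (\<Sum>x\<in>S. smult (of_real (w x)) (Px x ^ 2))"
  proof -
    have "pderiv P * Q - P * pderiv Q = (\<Sum>x\<in>S. smult (of_real (w x)) (pderiv P * Px x - P * pderiv (Px x)))"
      by (simp add: Q_def sum_distrib_left pderiv_sum pderiv_smult sum_subtractf smult_diff_right)
    also have "\<dots> = (\<Sum>x\<in>S. smult (of_real (w x)) (Px x ^ 2))"
    proof (intro sum.cong refl)
      fix x assume "x \<in> S"
      have "pderiv (lin x) = 1" by (simp add: lin_def pderiv_pCons)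
      then have "pderiv P = lin x * pderiv (Px x) + Px x"
        by (subst Pf[OF \<open>x \<in> S\<close>]) (simp add: pderiv_mult)
      then have "pderiv P * Px x - P * pderiv (Px x) = Px x ^ 2"
        by (subst (2) Pf[OF \<open>x \<in> S\<close>]) (simp add: power2_eq_square algebra_simps)
      then show "smult (of_real (w x)) (pderiv P * Px x - P * pderiv (Px x)) = smult (of_real (w x)) (Px x ^ 2)"
        by simp
    qed
    finally show ?thesis .
  qed
  \<comment> \<open>Real-valued forms, on the real line, of \<open>Q\<close> and of the Wronskian of
    \<open>R\<close> and \<open>Q\<close>. At a zero of \<open>R\<close> the latter is just
    \<open>R' Q\<close>.\<close>
  define q where "q t = (\<Sum>x\<in>S. w x * (\<Prod>s\<in>S - {x}. t - s))" for t :: real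
  define v where "v t = n * (\<Sum>x\<in>S. w x * (\<Prod>s\<in>S - {x}. t - s)\<^sup>2) - (real n - 1) * (q t)\<^sup>2" for t :: real
  have Px_real: "poly (Px x) (of_real t) = of_real (\<Prod>s\<in>S - {x}. t - s)" for x t
    by (simp add: Px0)
  have Q_real: "poly Q (of_real t) = of_real (q t)" for t
    by (simp add: Q0 Px_real q_def scaleR_conv_of_real)
  have wronskiR: "pderiv R * Q - R * pderiv Q = smult (of_nat n) (pderiv P * Q - P * pderiv Q) - smult (of_real (real n - 1)) (Q\<^sup>2)"
    by (simp add: R_def pderiv_diff pderiv_smult pderiv_mult pderiv_pCons power2_eq_square algebra_simps smult_diff_right smult_add_right)
  have v_real: "poly (pderiv R) (of_real t) * poly Q (of_real t) = of_real (v t)"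
    if "poly R (of_real t) = 0" for t
  proof -
    have "poly (pderiv R * Q - R * pderiv Q) (of_real t) = of_real (v t)"
      unfolding wronskiR wronski by (simp add: poly_sum Px_real Q_real v_def)
    then show ?thesis using that by simp
  qed
  have qv: "0 < (q t)\<^sup>2" "(q t)\<^sup>2 \<le> v t" if "poly R (of_real t) = 0" for t
  proof -
    show "0 < (q t)\<^sup>2" using Qroot[OF that] by (simp add: Q_real)
    have "(q t)\<^sup>2 \<le> (\<Sum>x\<in>S. w x * (\<Prod>s\<in>S - {x}. t - s)\<^sup>2)"
      unfolding q_def by (rule weighted_mean_square_le) (use S w w1 in \<open>auto intro: less_imp_le\<close>)
    then show "(q t)\<^sup>2 \<le> v t" unfolding v_def by (rule key)
  qed

  \<comment> \<open>Zeros of \<open>R\<close> and the partial fraction expansion\<close>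
  define Tc where "Tc = {z. poly R z = 0}"
  define T where "T = Re ` Tc"
  have Tc_real: "z = of_real (Re z)" if "z \<in> Tc" for z
    using real_root[of z] that by (simp add: Tc_def complex_eq_iff)
  have TcT: "Tc = of_real ` T"
    unfolding T_def image_image using Tc_real by force
  have T_root: "poly R (of_real t) = 0" if "t \<in> T" for t
    using that TcT by (auto simp: Tc_def)
  have finTc: "finite Tc" unfolding Tc_def by (rule poly_roots_finite[OF R0])
  have simple: "poly (pderiv R) z \<noteq> 0" if "z \<in> Tc" for z
    using v_real[of "Re z"] qv[of "Re z"] that Tc_real[OF that] by (auto simp: Tc_def)
  have "rsquarefree R"
    using simple by (auto simp: rsquarefree_roots Tc_def)
  from complex_poly_decompose_rsquarefree[OF this]
  have Rprod: "R = (\<Prod>z\<in>Tc. [:-z, 1:])"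
    by (simp add: Rlead Tc_def)
  have "degree R = (\<Sum>z\<in>Tc. degree [:-z, 1:])"
    unfolding Rprod by (rule degree_prod_eq_sum_degree) auto
  \<comment> \<open>Since the zeros are simple, their number is the degree of \<open>R\<close>; this
    yields the bound \<open>degree Q < card Tc\<close> that interpolation needs.\<close>
  then have cardT: "card Tc = card S" by (simp add: degR)
  have Qpf: "Q = (\<Sum>r\<in>Tc. smult (poly Q r / poly (pderiv R) r) (\<Prod>s\<in>Tc - {r}. [:-s, 1:]))"
    by (rule lagrange_partial_fractions[OF finTc Rprod]) (use degQ cardT cS in linarith)
  \<comment> \<open>The residue \<open>Q / R'\<close> expanded by \<open>Q\<close>, a form whose
    positivity is clear from \<open>qv\<close>.\<close>
  define p where "p t = (q t)\<^sup>2 / v t" for t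
  have pres: "poly Q (of_real t) / poly (pderiv R) (of_real t) = of_real (p t)" if "t \<in> T" for t
  proof -
    have "poly (pderiv R) (of_real t) \<noteq> 0" using simple that TcT by blast
    moreover have "poly Q (of_real t) \<noteq> 0" using Qroot T_root that by blast
    ultimately have "poly Q (of_real t) / poly (pderiv R) (of_real t) = poly Q (of_real t) ^ 2 / (poly (pderiv R) (of_real t) * poly Q (of_real t))"
      by (simp add: power2_eq_square)
    also have "\<dots> = of_real (p t)"
      unfolding v_real[OF T_root[OF that]] by (simp add: Q_real p_def)
    finally show ?thesis .
  qed
  show ?thesis
  proof (rule that)
    show "finite T" using finTc by (simp add: T_def)
    show "0 < p r" if "r \<in> T" for r
      using qv[OF T_root[OF that]] unfolding p_def by (intro divide_pos_pos) linarith+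
    fix z :: complex assume zS: "z \<notin> of_real ` S" and zT: "z \<notin> of_real ` T"
    have Pz: "poly P z \<noteq> 0" using zS S by (auto simp: P_def lin_def poly_prod)
    have Rz: "poly R z \<noteq> 0" using zT TcT by (auto simp: Tc_def)
    have GS: "(\<Sum>x\<in>S. w x / (z - x)) = poly Q z / poly P z"
    proof -
      have "poly Q z / poly P z = (\<Sum>x\<in>S. of_real (w x) * poly (Px x) z / poly P z)"
        by (simp add: Q0 scaleR_conv_of_real sum_divide_distrib)
      also have "\<dots> = (\<Sum>x\<in>S. w x / (z - x))"
      proof (intro sum.cong refl)
        fix x assume x: "x \<in> S"
        have "poly P z = (z - of_real x) * poly (Px x) z"
          by (subst Pf[OF x]) (simp add: lin_def algebra_simps)
        then show "of_real (w x) * poly (Px x) z / poly P z = w x / (z - x)"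
          using Pz by simp
      qed
      finally show ?thesis by simp
    qed
    have GT: "(\<Sum>r\<in>T. p r / (z - r)) = poly Q z / poly R z"
    proof -
      have "poly Q z / poly R z = (\<Sum>r\<in>Tc. poly Q r / poly (pderiv R) r * (poly (\<Prod>s\<in>Tc - {r}. [:-s, 1:]) z / poly R z))"
        by (subst Qpf) (simp add: poly_sum sum_divide_distrib)
      also have "\<dots> = (\<Sum>r\<in>Tc. poly Q r / poly (pderiv R) r / (z - r))"
      proof (intro sum.cong refl)
        fix r assume r: "r \<in> Tc"
        have "poly R z = (z - r) * poly (\<Prod>s\<in>Tc - {r}. [:-s, 1:]) z"
          unfolding Rprod using r finTc by (subst prod.remove[of _ r]) (auto simp: algebra_simps)
        then show "poly Q r / poly (pderiv R) r * (poly (\<Prod>s\<in>Tc - {r}. [:-s, 1:]) z / poly R z) = poly Q r / poly (pderiv R) r / (z - r)"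
          using Rz by simp
      qed
      also have "\<dots> = (\<Sum>r\<in>T. p r / (z - r))"
        unfolding TcT by (subst sum.reindex) (auto simp: inj_on_def pres[symmetric] intro!: sum.cong)
      finally show ?thesis by simp
    qed
    have "poly Q z / poly R z * (of_nat n - of_real (real n - 1) * (z * (poly Q z / poly P z))) = poly Q z / poly R z * (poly R z / poly P z)"
      using Pz by (simp add: R_def field_simps)
    also have "\<dots> = poly Q z / poly P z" using Rz by simp
    finally show "(\<Sum>r\<in>T. p r / (z - r)) * (n - (real n - 1) * (z * (\<Sum>x\<in>S. w x / (z - x)))) = (\<Sum>x\<in>S. w x / (z - x))"
      unfolding GS GT by simp
  qed
qed

text \<open>The moments of the n-th Boolean power of a law with moments \<open>a\<close>: the coefficient recursion of
  \<open>M * (n - (n - 1) * A) = A\<close>, where \<open>A\<close> and \<open>M\<close> are the two moment generating series.\<close>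

fun bool_moment :: "nat \<Rightarrow> (nat \<Rightarrow> real) \<Rightarrow> nat \<Rightarrow> real" where
  "bool_moment n a k = a k + (real n - 1) * (\<Sum>i<k. a (Suc i) * bool_moment n a (k - Suc i))"

declare bool_moment.simps [simp del]

section \<open>Moments of the finitely supported Boolean powers\<close>

lemma bool_moment_0 [simp]: "bool_moment n a 0 = a 0"
  by (subst bool_moment.simps) simp

text \<open>The value at \<open>k\<close> is a polynomial in \<open>a 0, ..., a k\<close>, so
  convergence up to order \<open>K\<close> suffices; later \<open>K\<close> is 6.\<close>

lemma tendsto_bool_moment:
  assumes "\<And>k. k \<le> K \<Longrightarrow> (\<lambda>j. a j k) \<longlonglongrightarrow> b k" "k \<le> K"
  shows "(\<lambda>j. bool_moment n (a j) k) \<longlonglongrightarrow> bool_moment n b k"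
  using assms(2)
proof (induction k rule: less_induct)
  case (less k)
  show ?case
    unfolding bool_moment.simps[of n _ k]
    by (intro tendsto_intros assms(1) less) (use less.prems in auto)
qed

text \<open>Geometric series near 0. At \<open>u = 1 / z\<close> the function is \<open>z\<close>
  times the Cauchy transform, which links that transform to the moments.\<close>

lemma has_fps_expansion_moment_series:
  fixes w :: "real \<Rightarrow> real"
  assumes "finite S"
  shows "(\<lambda>u::complex. \<Sum>x\<in>S. w x / (1 - x * u)) has_fps_expansion
           Abs_fps (\<lambda>k. of_real (\<Sum>x\<in>S. w x * x ^ k))"
proof (rule has_fps_expansionI)
  have "eventually (\<lambda>u::complex. norm (of_real x * u) < 1) (nhds 0)" for x :: real
  proof -
    have "((\<lambda>u::complex. norm (of_real x * u)) \<longlongrightarrow> norm (of_real x * (0::complex))) (nhds 0)"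
      by (intro tendsto_intros filterlim_ident)
    then show ?thesis by (rule order_tendstoD) simp
  qed
  then have "eventually (\<lambda>u::complex. \<forall>x\<in>S. norm (of_real x * u) < 1) (nhds 0)"
    using assms by (intro eventually_ball_finite) auto
  then show "eventually (\<lambda>u::complex. (\<lambda>k. fps_nth (Abs_fps (\<lambda>k. of_real (\<Sum>x\<in>S. w x * x ^ k))) k * u ^ k)
               sums (\<Sum>x\<in>S. w x / (1 - x * u))) (nhds 0)"
  proof eventually_elim
    case (elim u)
    have "(\<lambda>k. \<Sum>x\<in>S. of_real (w x) * (of_real x * u) ^ k) sums (\<Sum>x\<in>S. of_real (w x) * (1 / (1 - of_real x * u)))"
      by (intro sums_sum sums_mult geometric_sums) (use elim in auto)
    then show ?case
      by (simp add: sum_distrib_left power_mult_distrib mult_ac)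
  qed
qed

text \<open>Substituting \<open>z = 1 / u\<close> turns the equation of the transforms into one
  between moment generating functions near 0. Comparing Taylor coefficients gives the recursion that
  defines \<open>bool_moment\<close>.\<close>

lemma finite_boolean_power_moments:
  fixes w p :: "real \<Rightarrow> real" and n :: nat
  assumes S: "finite S" and T: "finite T" and w1: "sum w S = 1"
    and G: "\<And>z::complex. z \<notin> of_real ` S \<Longrightarrow> z \<notin> of_real ` T \<Longrightarrow>
       (\<Sum>r\<in>T. p r / (z - r)) * (n - (real n - 1) * (z * (\<Sum>x\<in>S. w x / (z - x)))) = (\<Sum>x\<in>S. w x / (z - x))"
  shows "(\<Sum>r\<in>T. p r * r ^ k) = bool_moment n (\<lambda>k. \<Sum>x\<in>S. w x * x ^ k) k"
proof -
  define MS where "MS u = (\<Sum>x\<in>S. w x / (1 - x * u))" for u :: complex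
  define MT where "MT u = (\<Sum>x\<in>T. p x / (1 - x * u))" for u :: complex
  define a where "a k = (\<Sum>x\<in>S. w x * x ^ k)" for k
  define c where "c k = (\<Sum>x\<in>T. p x * x ^ k)" for k
  define A where "A = Abs_fps (\<lambda>k. complex_of_real (a k))"
  define B where "B = Abs_fps (\<lambda>k. complex_of_real (c k))"
  have A: "MS has_fps_expansion A"
    unfolding MS_def A_def a_def by (rule has_fps_expansion_moment_series[OF S])
  have B: "MT has_fps_expansion B"
    unfolding MT_def B_def c_def by (rule has_fps_expansion_moment_series[OF T])
  \<comment> \<open>Each Cauchy transform at \<open>1 / u\<close> carries a factor \<open>u\<close>.
    Keeping one on both sides makes the identity trivial at \<open>u = 0\<close>, where the
    substitution is meaningless; it is cancelled later as \<open>fps_X\<close>.\<close>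
  have ev: "eventually (\<lambda>u. u * (MT u * (of_nat n - of_real (real n - 1) * MS u)) = u * MS u) (nhds 0)"
  proof -
    have "eventually (\<lambda>u::complex. \<forall>x\<in>S \<union> T. of_real x * u \<noteq> 1) (nhds 0)"
    proof (intro eventually_ball_finite ballI)
      fix x :: real
      have "((\<lambda>u::complex. of_real x * u) \<longlongrightarrow> of_real x * 0) (nhds 0)"
        by (intro tendsto_intros filterlim_ident)
      then show "eventually (\<lambda>u::complex. of_real x * u \<noteq> 1) (nhds 0)"
        by (rule tendsto_imp_eventually_ne) simp
    qed (use S T in auto)
    then show ?thesis
    proof eventually_elim
      case (elim u)
      show ?case
      proof (cases "u = 0")
        case False
        have *: "(\<Sum>x\<in>X. f x / (1 / u - of_real x)) = u * (\<Sum>x\<in>X. f x / (1 - of_real x * u))"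
          for X and f :: "real \<Rightarrow> complex"
        proof -
          have "f x / (1 / u - of_real x) = u * (f x / (1 - of_real x * u))" for x
            using False by (simp add: divide_simps) 
          then show ?thesis by (simp only: sum_distrib_left)
        qed
        have "1 / u \<notin> of_real ` X" if "X \<subseteq> S \<union> T" for X
        proof
          assume "1 / u \<in> of_real ` X"
          then obtain x where "x \<in> X" "1 / u = of_real x" by auto
          then have "of_real x * u = 1" using False by (simp add: field_simps)
          then show False using elim \<open>x \<in> X\<close> that by auto
        qed
        then have "1 / u \<notin> of_real ` S" "1 / u \<notin> of_real ` T" by auto
        from G[OF this] show ?thesis
          using False by (simp add: * MS_def MT_def mult_ac)
      qed simp
    qed
  qed
  have "(\<lambda>u. u * (MT u * (of_nat n - of_real (real n - 1) * MS u))) has_fps_expansion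
          fps_X * (B * (fps_const (of_nat n) - fps_const (of_real (real n - 1)) * A))"
    by (intro fps_expansion_intros A B)
  moreover have "(\<lambda>u. u * (MT u * (of_nat n - of_real (real n - 1) * MS u))) has_fps_expansion fps_X * A"
  proof -
    have "(\<lambda>u. u * MS u) has_fps_expansion fps_X * A"
      by (intro fps_expansion_intros A)
    then show ?thesis
      unfolding has_fps_expansion_def using ev by (auto elim: eventually_elim2)
  qed
  ultimately have "fps_X * (B * (fps_const (of_nat n) - fps_const (of_real (real n - 1)) * A)) = fps_X * A"
    using fps_nth_fps_expansion by (intro fps_ext) metis
  then have BA: "B * (fps_const (of_nat n) - fps_const (of_real (real n - 1)) * A) = A"
    by simp
  have rec: "c k = a k + (real n - 1) * (\<Sum>i<k. a (Suc i) * c (k - Suc i))" for k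
  proof -
    have AB: "fps_nth (A * B) k = of_real (\<Sum>i=0..k. a i * c (k - i))"
      by (simp add: fps_mult_nth A_def B_def)
    have "fps_const (of_nat n) * B - fps_const (of_real (real n - 1)) * (A * B) = A"
      using BA by (simp add: algebra_simps)
    then have "fps_nth (fps_const (of_nat n) * B - fps_const (of_real (real n - 1)) * (A * B)) k = fps_nth A k"
      by simp
    then have "complex_of_real (real n * c k - (real n - 1) * (\<Sum>i=0..k. a i * c (k - i))) = complex_of_real (a k)"
      unfolding fps_sub_nth fps_mult_left_const_nth AB by (simp add: A_def B_def)
    then have "real n * c k - (real n - 1) * (\<Sum>i=0..k. a i * c (k - i)) = a k"
      by (simp only: of_real_eq_iff)
    \<comment> \<open>The term \<open>i = 0\<close> equals \<open>c k\<close> because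
      \<open>a 0 = 1\<close>. Moving it to the left leaves \<open>n - (n - 1) = 1\<close> copies of
      \<open>c k\<close>, so the recursion is solved for \<open>c k\<close>.\<close>
    moreover have "(\<Sum>i=0..k. a i * c (k - i)) = c k + (\<Sum>i<k. a (Suc i) * c (k - Suc i))"
    proof -
      have "(\<Sum>i=0..k. a i * c (k - i)) = (\<Sum>i<Suc k. a i * c (k - i))"
        by (simp add: atLeast0AtMost lessThan_Suc_atMost)
      also have "\<dots> = a 0 * c k + (\<Sum>i<k. a (Suc i) * c (k - Suc i))"
        by (subst sum.lessThan_Suc_shift) simp
      finally show ?thesis using w1 by (simp add: a_def)
    qed
    ultimately show ?thesis by (simp add: algebra_simps)
  qed
  have "c k = bool_moment n a k"
  proof (induction k rule: less_induct)
    case (less k)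
    then show ?case
      by (subst rec, subst bool_moment.simps) (auto intro!: sum.cong)
  qed
  then show ?thesis by (simp add: c_def a_def[abs_def])
qed

section \<open>Uniqueness by Stieltjes inversion\<close>

lemma Im_inverse_complex_of_real:
  "Im (1 / (Complex x y - of_real t)) = - (y / ((x - t)\<^sup>2 + y\<^sup>2))"
  by (simp add: Im_divide)

lemma norm_resolvent_le:
  assumes "Im z > 0"
  shows "norm (1 / (z - complex_of_real t)) \<le> 1 / Im z"
proof -
  have "Im z \<le> norm (z - complex_of_real t)"
    using abs_Im_le_cmod[of "z - complex_of_real t"] by simp
  then show ?thesis using assms by (simp add: norm_divide frac_le)
qed

lemma integrable_resolvent:
  fixes \<mu> :: "real measure"
  assumes "real_distribution \<mu>" "Im z > 0"
  shows "integrable \<mu> (\<lambda>t. 1 / (z - complex_of_real t))"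
proof -
  interpret real_distribution \<mu> by fact
  show ?thesis
    by (intro integrable_const_bound[where B = "1 / Im z"]) (use norm_resolvent_le[OF assms(2)] in auto)
qed

lemma Im_cauchy_transform:
  assumes "real_distribution \<mu>" "y > 0"
  shows "Im (cauchy_transform \<mu> (Complex x y)) = - (\<integral>t. y / ((x - t)\<^sup>2 + y\<^sup>2) \<partial>\<mu>)"
proof -
  have "Im (cauchy_transform \<mu> (Complex x y)) = (\<integral>t. Im (1 / (Complex x y - of_real t)) \<partial>\<mu>)"
    unfolding cauchy_transform_def
    by (rule integral_Im[symmetric]) (rule integrable_resolvent, use assms in auto)
  then show ?thesis by (simp add: Im_inverse_complex_of_real del: Im_divide)
qed

text \<open>The imaginary part is minus the mean of a strictly positive kernel. Hence
  \<open>recip_cauchy\<close> never meets the default value of division by 0 on the upper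
  half-plane.\<close>

lemma cauchy_transform_nonzero:
  assumes "real_distribution \<mu>" "Im z > 0"
  shows "cauchy_transform \<mu> z \<noteq> 0"
proof -
  interpret real_distribution \<mu> by fact
  obtain x y where z: "z = Complex x y" "y > 0" using assms(2) by (cases z) auto
  have pos: "0 < y / ((x - t)\<^sup>2 + y\<^sup>2)" for t
    using z by (intro divide_pos_pos) (auto simp: add_nonneg_pos)
  have int: "integrable \<mu> (\<lambda>t. y / ((x - t)\<^sup>2 + y\<^sup>2))"
    using integrable_Im[OF integrable_resolvent[OF assms]] unfolding z Im_inverse_complex_of_real by simp
  have "(\<integral>t. y / ((x - t)\<^sup>2 + y\<^sup>2) \<partial>\<mu>) \<noteq> 0"
  proof
    assume "(\<integral>t. y / ((x - t)\<^sup>2 + y\<^sup>2) \<partial>\<mu>) = 0"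
    then have "AE t in \<mu>. y / ((x - t)\<^sup>2 + y\<^sup>2) = 0"
      using integral_nonneg_eq_0_iff_AE[OF int] pos by (simp add: less_imp_le)
    then have "AE t in \<mu>. False" by (rule AE_mp) (use pos in \<open>auto simp: less_imp_neq[symmetric]\<close>)
    then show False by simp
  qed
  then have "Im (cauchy_transform \<mu> z) \<noteq> 0"
    unfolding z using Im_cauchy_transform[OF assms(1) z(2)] by simp
  then show ?thesis by auto
qed

text \<open>Fubini for the Poisson kernel, whose primitive in \<open>x\<close> is
  \<open>arctan ((x - t) / y)\<close>.\<close>

lemma integral_Im_cauchy_transform:
  assumes \<mu>: "real_distribution \<mu>" and y: "y > 0" and ab: "a \<le> b"
  shows "(\<integral>x. indicator {a..b} x * Im (cauchy_transform \<mu> (Complex x y)) \<partial>lborel)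
       = - (\<integral>t. arctan ((b - t) / y) - arctan ((a - t) / y) \<partial>\<mu>)"
proof -
  interpret real_distribution \<mu> by fact
  interpret pair: pair_sigma_finite lborel \<mu> ..
  define k where "k x t = y / ((x - t)\<^sup>2 + y\<^sup>2)" for x t :: real
  have pos: "(x - t)\<^sup>2 + y\<^sup>2 > 0" for x t using y by (simp add: add_nonneg_pos)
  have kb: "norm (k x t) \<le> 1 / y" for x t
  proof -
    have "k x t \<le> y / y\<^sup>2" unfolding k_def using y pos by (intro frac_le) auto
    then show ?thesis using y pos[of x t] by (simp add: k_def power2_eq_square)
  qed
  have [measurable]: "case_prod k \<in> borel_measurable (lborel \<Otimes>\<^sub>M \<mu>)"
    unfolding k_def by measurable
  \<comment> \<open>On the strip over \<open>{a..b}\<close>, which has finite product measure, the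
    kernel is bounded by \<open>1 / y\<close>.\<close>
  have int: "integrable (lborel \<Otimes>\<^sub>M \<mu>) (\<lambda>p. indicator ({a..b} \<times> UNIV) p *\<^sub>R case_prod k p)"
  proof (rule integrableI_bounded_set_indicator[where B = "1 / y"])
    show "emeasure (lborel \<Otimes>\<^sub>M \<mu>) ({a..b} \<times> UNIV) < \<infinity>"
      using ab emeasure_space_1 by (simp add: emeasure_pair_measure_Times)
  qed (use kb in \<open>auto simp: case_prod_beta\<close>)
  have FTC: "(\<integral>x. indicator {a..b} x *\<^sub>R k x t \<partial>lborel) = arctan ((b - t) / y) - arctan ((a - t) / y)" for t
  proof (rule integral_FTC_atLeastAtMost[OF ab])
    fix x
    have "((\<lambda>x. arctan ((x - t) / y)) has_real_derivative k x t) (at x within {a..b})"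
      unfolding k_def using y pos[of x t]
      by (auto intro!: derivative_eq_intros simp: field_simps power2_eq_square)
    then show "((\<lambda>x. arctan ((x - t) / y)) has_vector_derivative k x t) (at x within {a..b})"
      by (rule has_real_derivative_iff_has_vector_derivative[THEN iffD1])
  next
    show "continuous_on {a..b} (\<lambda>x. k x t)"
      unfolding k_def using pos by (auto intro!: continuous_intros simp: less_imp_neq[symmetric])
  qed
  have "(\<integral>t. arctan ((b - t) / y) - arctan ((a - t) / y) \<partial>\<mu>)
      = (\<integral>t. (\<integral>x. indicator {a..b} x *\<^sub>R k x t \<partial>lborel) \<partial>\<mu>)"
    by (simp only: FTC)
  also have "\<dots> = (\<integral>x. (\<integral>t. indicator {a..b} x *\<^sub>R k x t \<partial>\<mu>) \<partial>lborel)"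
    by (rule pair.Fubini_integral) (use int in \<open>simp add: split_beta' indicator_times\<close>)
  also have "\<dots> = (\<integral>x. - (indicator {a..b} x * Im (cauchy_transform \<mu> (Complex x y))) \<partial>lborel)"
    unfolding Im_cauchy_transform[OF \<mu> y] k_def by (simp del: times_divide_eq_right)
  finally show ?thesis by simp
qed

lemma tendsto_arctan_mult_sgn:
  "(\<lambda>m. arctan (c * real (Suc m))) \<longlonglongrightarrow> pi / 2 * sgn c"
proof (cases c "0 :: real" rule: linorder_cases)
  case greater
  then have "filterlim (\<lambda>m. c * real (Suc m)) at_top sequentially"
    by (intro filterlim_tendsto_pos_mult_at_top[OF tendsto_const])
       (auto intro: filterlim_compose[OF filterlim_real_sequentially filterlim_Suc] simp del: of_nat_Suc)
  then show ?thesis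
    using greater by (auto intro: filterlim_compose[OF tendsto_arctan_at_top])
next
  case less
  then have "filterlim (\<lambda>m. c * real (Suc m)) at_bot sequentially"
    by (intro filterlim_tendsto_neg_mult_at_bot[OF tendsto_const])
       (auto intro: filterlim_compose[OF filterlim_real_sequentially filterlim_Suc] simp del: of_nat_Suc)
  then show ?thesis
    using less by (auto intro: filterlim_compose[OF tendsto_arctan_at_bot])
qed simp

text \<open>Dominated convergence along the heights \<open>1 / (m + 1)\<close>, with bound
  \<open>pi\<close>. As \<open>sgn 0 = 0\<close>, an atom at an endpoint is counted with half its
  mass when \<open>a < b\<close>.\<close>

lemma stieltjes_inversion:
  assumes \<mu>: "real_distribution \<mu>" and ab: "a \<le> b"
  shows "(\<lambda>m. - (\<integral>x. indicator {a..b} x * Im (cauchy_transform \<mu> (Complex x (1 / real (Suc m)))) \<partial>lborel))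
     \<longlonglongrightarrow> (\<integral>t. pi / 2 * sgn (b - t) - pi / 2 * sgn (a - t) \<partial>\<mu>)"
proof -
  interpret real_distribution \<mu> by fact
  have [simp]: "\<bar>arctan x - arctan y\<bar> \<le> pi" for x y
    using arctan_bounded[of x] arctan_bounded[of y] by linarith
  have "(\<lambda>m. \<integral>t. arctan ((b - t) * real (Suc m)) - arctan ((a - t) * real (Suc m)) \<partial>\<mu>)
     \<longlonglongrightarrow> (\<integral>t. pi / 2 * sgn (b - t) - pi / 2 * sgn (a - t) \<partial>\<mu>)"
  proof (rule integral_dominated_convergence[where w = "\<lambda>_. pi"])
    show "AE t in \<mu>. (\<lambda>m. arctan ((b - t) * real (Suc m)) - arctan ((a - t) * real (Suc m)))
            \<longlonglongrightarrow> pi / 2 * sgn (b - t) - pi / 2 * sgn (a - t)"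
      by (intro AE_I2 tendsto_diff tendsto_arctan_mult_sgn)
  qed (auto simp del: of_nat_Suc)
  then show ?thesis
    using integral_Im_cauchy_transform[OF \<mu> _ ab, of "1 / real (Suc m)" for m] by simp
qed

text \<open>Inversion determines the increments of the distribution function normalised to midpoints
  at its jumps. The limit at minus infinity fixes the additive constant, and right continuity
  recovers the usual distribution function.\<close>

lemma cauchy_transform_inject:
  assumes \<mu>: "real_distribution \<mu>" and \<nu>: "real_distribution \<nu>"
    and eq: "\<And>z. Im z > 0 \<Longrightarrow> cauchy_transform \<mu> z = cauchy_transform \<nu> z"
  shows "\<mu> = \<nu>"
proof -
  \<comment> \<open>This is the mass of the points below \<open>x\<close> plus half the mass at
    \<open>x\<close>; it lies between the values of \<open>cdf M\<close> to the left of
    \<open>x\<close> and at \<open>x\<close>.\<close>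
  define u where "u M x = (\<integral>t. (sgn (x - t) + 1) / 2 \<partial>M)" for M :: "real measure" and x :: real
  have int: "integrable M (\<lambda>t. sgn (x - t))" if "real_distribution M" for M and x :: real
  proof -
    interpret real_distribution M by fact
    show ?thesis by (rule integrable_const_bound[where B = 1]) (auto simp: sgn_real_def)
  qed
  have u_diff: "(\<integral>t. pi / 2 * sgn (b - t) - pi / 2 * sgn (a - t) \<partial>M) = pi * (u M b - u M a)"
    if M: "real_distribution M" for M a b
  proof -
    interpret real_distribution M by fact
    show ?thesis
      using int[OF M] prob_space by (simp add: u_def field_simps)
  qed
  have u_le: "u M x \<le> cdf M x" "0 \<le> u M x" if M: "real_distribution M" for M x
  proof -
    interpret real_distribution M by fact
    have cdf: "cdf M x = (\<integral>t. indicator {..x} t \<partial>M)" by (simp add: cdf_def)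
    have ind: "integrable M (indicator {..x} :: real \<Rightarrow> real)"
      by (rule integrable_const_bound[where B = 1]) auto
    have "u M x \<le> (\<integral>t. indicator {..x} t \<partial>M)"
      unfolding u_def by (rule integral_mono[OF _ ind]) (use int[OF M] in \<open>auto split: split_indicator simp: sgn_if\<close>)
    then show "u M x \<le> cdf M x" by (simp only: cdf)
    show "0 \<le> u M x" unfolding u_def by (rule Bochner_Integration.integral_nonneg) (auto simp: sgn_real_def)
  qed
  have cdf_le: "cdf M x \<le> u M x'" if M: "real_distribution M" and "x < x'" for M x x'
  proof -
    interpret real_distribution M by fact
    have ind: "integrable M (indicator {..x} :: real \<Rightarrow> real)"
      by (rule integrable_const_bound[where B = 1]) auto
    have "cdf M x = (\<integral>t. indicator {..x} t \<partial>M)" by (simp add: cdf_def)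
    also have "\<dots> \<le> u M x'"
      unfolding u_def by (rule integral_mono[OF ind]) (use int[OF M] that in \<open>auto split: split_indicator simp: sgn_if\<close>)
    finally show ?thesis .
  qed
  have diff_eq: "u \<mu> b - u \<mu> a = u \<nu> b - u \<nu> a" if ab: "a \<le> b" for a b
  proof -
    have eq': "cauchy_transform \<mu> (Complex x (1 / real (Suc m))) = cauchy_transform \<nu> (Complex x (1 / real (Suc m)))" for x m
      by (rule eq) simp
    have "pi * (u \<mu> b - u \<mu> a) = pi * (u \<nu> b - u \<nu> a)"
      unfolding u_diff[OF \<mu>, symmetric] u_diff[OF \<nu>, symmetric]
      using stieltjes_inversion[OF \<nu> ab]
      by (rule LIMSEQ_unique[OF stieltjes_inversion[OF \<mu> ab, unfolded eq']])
    then show ?thesis by simp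
  qed
  have u_eq: "u \<mu> x = u \<nu> x" for x
  proof -
    have lim: "(u M \<longlongrightarrow> 0) at_bot" if M: "real_distribution M" for M
    proof -
      interpret real_distribution M by fact
      show ?thesis
        by (rule tendsto_sandwich[OF _ _ tendsto_const cdf_lim_at_bot]) (use u_le[OF M] in auto)
    qed
    \<comment> \<open>The difference of the two functions is constant by \<open>diff_eq\<close>, so
      it equals its limit 0 at minus infinity.\<close>
    have "((\<lambda>a. u \<mu> a - u \<nu> a) \<longlongrightarrow> 0) at_bot"
      using tendsto_diff[OF lim[OF \<mu>] lim[OF \<nu>]] by simp
    moreover have ev: "eventually (\<lambda>a. u \<mu> a - u \<nu> a = u \<mu> x - u \<nu> x) at_bot"
      using eventually_le_at_bot[of x] by eventually_elim (use diff_eq[of _ x] in force)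
    ultimately have "((\<lambda>a::real. u \<mu> x - u \<nu> x) \<longlongrightarrow> 0) at_bot"
      using tendsto_cong[OF ev] by blast
    then show ?thesis by (simp add: tendsto_const_iff)
  qed
  have le: "cdf M x \<le> cdf N x"
    if M: "real_distribution M" and N: "real_distribution N" and "\<And>x. u M x = u N x" for M N x
  proof -
    interpret N: real_distribution N by fact
    have "(cdf N \<longlongrightarrow> cdf N x) (at_right x)"
      using N.cdf_is_right_cont[of x] by (simp add: continuous_within)
    moreover have "eventually (\<lambda>x'. cdf M x \<le> cdf N x') (at_right x)"
      using eventually_at_right_less[of x]
      by eventually_elim (use cdf_le[OF M] u_le(1)[OF N] that(3) in \<open>metis order_trans\<close>)
    ultimately show ?thesis
      by (intro tendsto_lowerbound) auto
  qed
  have "cdf \<mu> = cdf \<nu>"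
    using le[OF \<mu> \<nu> u_eq] le[OF \<nu> \<mu> u_eq[symmetric]] by (intro ext antisym)
  then show ?thesis using cdf_unique \<mu> \<nu> by blast
qed

section \<open>Existence of Boolean powers\<close>

text \<open>The approximants are the laws of simple functions \<open>F i\<close> that converge
  pointwise to the identity with \<open>\<bar>F i t\<bar> \<le> 2 * \<bar>t\<bar>\<close>. Dominated
  convergence, by the sixth moment or by the bound \<open>1 / Im z\<close>, gives both
  limits.\<close>

lemma discrete_approximation:
  fixes \<mu> :: "real measure"
  assumes \<mu>: "real_distribution \<mu>" and int6: "integrable \<mu> (\<lambda>t. t ^ 6)"
  obtains S :: "nat \<Rightarrow> real set" and w :: "nat \<Rightarrow> real \<Rightarrow> real"
  where "\<And>i. finite (S i)" "\<And>i x. x \<in> S i \<Longrightarrow> 0 < w i x" "\<And>i. sum (w i) (S i) = 1"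
    "\<And>k. k \<le> 6 \<Longrightarrow> (\<lambda>i. \<Sum>x\<in>S i. w i x * x ^ k) \<longlonglongrightarrow> moment k \<mu>"
    "\<And>z::complex. Im z > 0 \<Longrightarrow> (\<lambda>i. \<Sum>x\<in>S i. complex_of_real (w i x) / (z - complex_of_real x)) \<longlonglongrightarrow> cauchy_transform \<mu> z"
proof -
  interpret real_distribution \<mu> by fact
  obtain F where F: "\<And>i. simple_function \<mu> (F i)" "\<And>t. (\<lambda>i. F i t) \<longlonglongrightarrow> t"
    "\<And>i t. \<bar>F i t\<bar> \<le> 2 * \<bar>t\<bar>"
    using borel_measurable_implies_sequence_metric[of "\<lambda>t::real. t" \<mu> 0] by auto
  define w where "w i x = measure \<mu> (F i -` {x})" for i x
  \<comment> \<open>Values taken with probability 0 are dropped, since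
    \<open>finite_boolean_power\<close> asks for positive weights.\<close>
  define S where "S i = {x \<in> range (F i). 0 < w i x}" for i
  have finF: "finite (range (F i))" for i
    using simple_functionD(1)[OF F(1)[of i]] by simp
  have meas[measurable]: "F i \<in> borel_measurable \<mu>" for i
    using F(1) by (rule borel_measurable_simple_function)
  have sets: "F i -` {x} \<in> sets borel" for i x
    using measurable_sets[OF meas[of i], of "{x}"] by simp
  have expF: "(\<Sum>x\<in>S i. w i x *\<^sub>R g x) = (\<integral>t. g (F i t) \<partial>\<mu>)"
    for i and g :: "real \<Rightarrow> 'b::{banach, second_countable_topology}"
  proof -
    have "(\<integral>t. g (F i t) \<partial>\<mu>) = (\<integral>t. (\<Sum>x\<in>range (F i). indicator (F i -` {x}) t *\<^sub>R g x) \<partial>\<mu>)"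
    proof (intro Bochner_Integration.integral_cong refl)
      fix t
      have "(\<Sum>x\<in>range (F i). indicator (F i -` {x}) t *\<^sub>R g x) = (\<Sum>x\<in>range (F i). if x = F i t then g x else 0)"
        by (intro sum.cong) auto
      also have "\<dots> = g (F i t)" using finF by simp
      finally show "g (F i t) = (\<Sum>x\<in>range (F i). indicator (F i -` {x}) t *\<^sub>R g x)" by simp
    qed
    also have "\<dots> = (\<Sum>x\<in>range (F i). (\<integral>t. indicator (F i -` {x}) t *\<^sub>R g x \<partial>\<mu>))"
      by (intro Bochner_Integration.integral_sum integrable_scaleR_left integrable_real_indicator)
         (auto simp: sets emeasure_eq_measure)
    also have "\<dots> = (\<Sum>x\<in>range (F i). w i x *\<^sub>R g x)"
      unfolding w_def using sets by (simp add: emeasure_eq_measure)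
    also have "\<dots> = (\<Sum>x\<in>S i. w i x *\<^sub>R g x)"
      by (rule sum.mono_neutral_right[OF finF]) (auto simp: S_def w_def zero_less_measure_iff)
    finally show ?thesis by simp
  qed
  show ?thesis
  proof (rule that)
    show "finite (S i)" for i using finF[of i] by (auto simp: S_def)
    show "0 < w i x" if "x \<in> S i" for i x using that by (simp add: S_def)
    show "sum (w i) (S i) = 1" for i
      using expF[of i "\<lambda>_. 1::real"] prob_space by simp
    fix k :: nat assume k: "k \<le> 6"
    \<comment> \<open>The constant is \<open>2 ^ 6\<close>, from the factor 2 in the bound on
      \<open>F i\<close>.\<close>
    have bnd: "\<bar>F i t ^ k\<bar> \<le> 64 * (1 + t ^ 6)" for i t
    proof -
      have "\<bar>F i t ^ k\<bar> \<le> (2 * \<bar>t\<bar>) ^ k"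
        unfolding power_abs using F(3) by (intro power_mono) auto
      also have "\<dots> \<le> 64 * (1 + t ^ 6)"
      proof -
        have "(2::real) ^ k \<le> 2 ^ 6" using k by (intro power_increasing) auto
        moreover have "\<bar>t\<bar> ^ k \<le> 1 + t ^ 6"
        proof (cases "\<bar>t\<bar> \<le> 1")
          case True
          then have "\<bar>t\<bar> ^ k \<le> 1" by (intro power_le_one) auto
          moreover have "0 \<le> t ^ 6" by simp
          ultimately show ?thesis by linarith
        next
          case False
          then have "\<bar>t\<bar> ^ k \<le> \<bar>t\<bar> ^ 6" using k by (intro power_increasing) auto
          also have "\<dots> = t ^ 6" by (simp add: power_even_abs)
          finally show ?thesis by simp
        qed
        ultimately have "2 ^ k * \<bar>t\<bar> ^ k \<le> 2 ^ 6 * (1 + t ^ 6)"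
          by (intro mult_mono) auto
        then show ?thesis by (simp add: power_mult_distrib)
      qed
      finally show ?thesis .
    qed
    have "(\<lambda>i. \<integral>t. F i t ^ k \<partial>\<mu>) \<longlonglongrightarrow> (\<integral>t. t ^ k \<partial>\<mu>)"
      by (rule integral_dominated_convergence[where w = "\<lambda>t. 64 * (1 + t ^ 6)"])
         (use int6 F(2) bnd in \<open>auto intro!: tendsto_intros\<close>)
    then show "(\<lambda>i. \<Sum>x\<in>S i. w i x * x ^ k) \<longlonglongrightarrow> moment k \<mu>"
      using expF[of _ "\<lambda>t. t ^ k"] by (simp add: moment_def)
  next
    fix z assume z: "Im z > 0"
    have ne: "z \<noteq> of_real t" for t using z by auto
    have "(\<lambda>i. \<integral>t. 1 / (z - of_real (F i t)) \<partial>\<mu>) \<longlonglongrightarrow> (\<integral>t. 1 / (z - of_real t) \<partial>\<mu>)"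
    proof (rule integral_dominated_convergence[where w = "\<lambda>t. 1 / Im z"])
      show "AE t in \<mu>. (\<lambda>i. 1 / (z - of_real (F i t))) \<longlonglongrightarrow> 1 / (z - of_real t)"
        using F(2) ne by (auto intro!: tendsto_intros)
      show "AE t in \<mu>. norm (1 / (z - of_real (F i t))) \<le> 1 / Im z" for i
        by (rule AE_I2) (rule norm_resolvent_le[OF z])
    qed auto
    then show "(\<lambda>i. \<Sum>x\<in>S i. complex_of_real (w i x) / (z - complex_of_real x)) \<longlonglongrightarrow> cauchy_transform \<mu> z"
      using expF[of _ "\<lambda>t. 1 / (z - of_real t)"] by (simp add: cauchy_transform_def scaleR_conv_of_real)
  qed
qed

lemma finite_distribution:
  fixes p :: "real \<Rightarrow> real"
  assumes T: "finite T" and p: "\<And>t. t \<in> T \<Longrightarrow> 0 < p t" and p1: "sum p T = 1"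
  obtains M where "real_distribution M"
    "\<And>f :: real \<Rightarrow> real. f \<in> borel_measurable borel \<Longrightarrow> integral\<^sup>L M f = (\<Sum>t\<in>T. p t * f t)"
    "\<And>f :: real \<Rightarrow> complex. f \<in> borel_measurable borel \<Longrightarrow> integral\<^sup>L M f = (\<Sum>t\<in>T. of_real (p t) * f t)"
proof -
  define g where "g t = (if t \<in> T then p t else 0)" for t
  have g0: "0 \<le> g t" for t using p[of t] by (auto simp: g_def)
  have "(\<integral>\<^sup>+x. ennreal (g x) \<partial>count_space UNIV) = (\<Sum>x\<in>T. ennreal (g x))"
    using T by (intro nn_integral_count_space') (auto simp: g_def)
  also have "\<dots> = ennreal (\<Sum>x\<in>T. g x)" using g0 by (intro sum_ennreal) auto
  also have "\<dots> = 1" using p1 by (simp add: g_def cong: sum.cong)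
  finally have g1: "(\<integral>\<^sup>+x. ennreal (g x) \<partial>count_space UNIV) = 1" .
  define M where "M = distr (measure_pmf (embed_pmf g)) borel (\<lambda>x. x)"
  have E: "integral\<^sup>L M f = (\<Sum>t\<in>T. p t *\<^sub>R f t)" if [measurable]: "f \<in> borel_measurable borel"
    for f :: "real \<Rightarrow> 'b::{banach, second_countable_topology}"
  proof -
    have "integral\<^sup>L M f = integral\<^sup>L (measure_pmf (embed_pmf g)) f"
      unfolding M_def by (subst integral_distr) auto
    also have "\<dots> = (\<Sum>t\<in>T. pmf (embed_pmf g) t *\<^sub>R f t)"
      by (rule integral_measure_pmf[OF T]) (auto simp: set_embed_pmf[OF g0 g1] g_def split: if_splits)
    also have "\<dots> = (\<Sum>t\<in>T. p t *\<^sub>R f t)"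
      by (intro sum.cong) (auto simp: pmf_embed_pmf[OF g0 g1] g_def)
    finally show ?thesis .
  qed
  show ?thesis
  proof (rule that)
    show "real_distribution M"
      unfolding M_def by (rule prob_space.real_distribution_distr) (auto intro: prob_space_measure_pmf)
  qed (auto simp: E scaleR_conv_of_real)
qed

text \<open>A weak limit of the finitely supported powers inherits the equation of the transforms.
  Moments need not converge to those of the limit, so the moment information is kept in the form of
  Markov's inequality for nonnegative polynomials of degree at most 6.\<close>

lemma boolean_power_exists:
  fixes \<mu> :: "real measure" and n :: nat
  assumes \<mu>: "real_distribution \<mu>" and int6: "integrable \<mu> (\<lambda>t. t ^ 6)" and n: "n \<ge> 1"
  obtains \<rho> where "real_distribution \<rho>"
    "\<And>z::complex. Im z > 0 \<Longrightarrow> recip_cauchy \<rho> z = n * recip_cauchy \<mu> z - (real n - 1) * z"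
    "\<And>q \<delta>. (\<And>t. 0 \<le> (\<Sum>k\<le>6. q k * t ^ k)) \<Longrightarrow> 0 < \<delta> \<Longrightarrow>
       \<delta> * measure \<rho> {t. \<delta> \<le> (\<Sum>k\<le>6. q k * t ^ k)} \<le> (\<Sum>k\<le>6. q k * bool_moment n (\<lambda>k. moment k \<mu>) k)"
proof -
  obtain S w where S: "\<And>i. finite (S i)" "\<And>i x. x \<in> S i \<Longrightarrow> 0 < w i x" "\<And>i. sum (w i) (S i) = 1"
    and mom: "\<And>k. k \<le> 6 \<Longrightarrow> (\<lambda>i. \<Sum>x\<in>S i. w i x * x ^ k) \<longlonglongrightarrow> moment k \<mu>"
    and G\<mu>: "\<And>z::complex. Im z > 0 \<Longrightarrow> (\<lambda>i. \<Sum>x\<in>S i. complex_of_real (w i x) / (z - complex_of_real x)) \<longlonglongrightarrow> cauchy_transform \<mu> z"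
    by (rule discrete_approximation[OF \<mu> int6]) blast
  define GS where "GS i z = (\<Sum>x\<in>S i. complex_of_real (w i x) / (z - complex_of_real x))" for i z
  define good where "good i T p \<longleftrightarrow> finite T \<and> (\<forall>r\<in>T. 0 < p r) \<and>
      (\<forall>z. z \<notin> of_real ` S i \<longrightarrow> z \<notin> of_real ` T \<longrightarrow>
       (\<Sum>r\<in>T. of_real (p r) / (z - of_real r)) * (of_nat n - of_real (real n - 1) * (z * GS i z)) = GS i z)"
    for i and T :: "real set" and p :: "real \<Rightarrow> real"
  have "\<exists>T p. good i T p" for i
    unfolding good_def GS_def
    by (rule finite_boolean_power[OF S(1)[of i] S(2) S(3)[of i] n]) blast+
  then obtain T p where good: "\<And>i. good i (T i) (p i)" by metis
  have T: "finite (T i)" "\<And>r. r \<in> T i \<Longrightarrow> 0 < p i r" for i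
    using good[of i] by (auto simp: good_def)
  have GT: "(\<Sum>r\<in>T i. of_real (p i r) / (z - of_real r)) * (of_nat n - of_real (real n - 1) * (z * GS i z)) = GS i z"
    if "z \<notin> of_real ` S i" "z \<notin> of_real ` T i" for i z
    using good[of i] that by (simp add: good_def)
  have mT: "(\<Sum>r\<in>T i. p i r * r ^ k) = bool_moment n (\<lambda>k. \<Sum>x\<in>S i. w i x * x ^ k) k" for i k
    by (rule finite_boolean_power_moments[OF S(1) T(1) S(3) GT[unfolded GS_def]])
  have p1: "sum (p i) (T i) = 1" for i
    using mT[of i 0] S(3)[of i] by simp
  have limT: "(\<lambda>i. \<Sum>r\<in>T i. p i r * r ^ k) \<longlonglongrightarrow> bool_moment n (\<lambda>k. moment k \<mu>) k" if "k \<le> 6" for k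
    unfolding mT by (rule tendsto_bool_moment[OF mom that])
  define law where "law i M \<longleftrightarrow> real_distribution M \<and>
    (\<forall>f :: real \<Rightarrow> real. f \<in> borel_measurable borel \<longrightarrow> integral\<^sup>L M f = (\<Sum>t\<in>T i. p i t * f t)) \<and>
    (\<forall>f :: real \<Rightarrow> complex. f \<in> borel_measurable borel \<longrightarrow> integral\<^sup>L M f = (\<Sum>t\<in>T i. of_real (p i t) * f t))"
    for i M
  have "\<exists>M. law i M" for i
    unfolding law_def by (rule finite_distribution[OF T(1)[of i] T(2) p1[of i]]) blast+
  then obtain M where law: "\<And>i. law i (M i)" by metis
  have M: "real_distribution (M i)" for i
    using law[of i] by (simp add: law_def)
  have ER: "integral\<^sup>L (M i) f = (\<Sum>t\<in>T i. p i t * f t)" if "f \<in> borel_measurable borel" for i and f :: "real \<Rightarrow> real"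
    using law[of i] that by (simp add: law_def)
  have EC: "integral\<^sup>L (M i) f = (\<Sum>t\<in>T i. of_real (p i t) * f t)" if "f \<in> borel_measurable borel" for i and f :: "real \<Rightarrow> complex"
    using law[of i] that by (simp add: law_def)

  \<comment> \<open>Tightness and the weak limit\<close>
  have "tight M"
    unfolding tight_def
  proof (intro conjI allI impI)
    show "real_distribution (M i)" for i by (rule M)
    fix \<epsilon> :: real assume \<epsilon>: "\<epsilon> > 0"
    have "Bseq (\<lambda>i. \<Sum>r\<in>T i. p i r * r ^ 2)"
      by (rule convergent_imp_Bseq, rule convergentI, rule limT) simp
    then obtain B where B: "B > 0" "\<And>i. \<bar>\<Sum>r\<in>T i. p i r * r ^ 2\<bar> \<le> B"
      by (auto simp: Bseq_def)
    \<comment> \<open>With this choice \<open>K \<ge> 1\<close> and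
      \<open>B < \<epsilon> * K\<close>, so Chebyshev's bound \<open>B / K^2\<close> is below
      \<open>\<epsilon>\<close>.\<close>
    define K where "K = 1 + B / \<epsilon>"
    have K: "K \<ge> 1" using B \<epsilon> by (simp add: K_def)
    have "B / K\<^sup>2 < \<epsilon>"
    proof -
      have "B < \<epsilon> * K" using \<epsilon> by (simp add: K_def algebra_simps)
      also have "\<dots> \<le> \<epsilon> * K\<^sup>2" using K \<epsilon> by (intro mult_left_mono) (auto simp: power2_eq_square)
      finally show ?thesis using K by (simp add: divide_simps)
    qed
    have "1 - \<epsilon> < measure (M i) {- K<..K}" for i
    proof -
      interpret real_distribution "M i" by (rule M)
      have "measure (M i) {- K<..K} = (\<Sum>t\<in>T i. p i t * indicator {- K<..K} t)"
        using ER[of "indicator {- K<..K}" i] by simp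
      then have "1 - measure (M i) {- K<..K} = (\<Sum>t\<in>T i. p i t * (1 - indicator {- K<..K} t))"
        using p1[of i] by (simp add: right_diff_distrib sum_subtractf)
      also have "\<dots> \<le> (\<Sum>t\<in>T i. p i t * (t\<^sup>2 / K\<^sup>2))"
      proof (intro sum_mono mult_left_mono)
        fix t assume "t \<in> T i"
        show "0 \<le> p i t" using T(2)[OF \<open>t \<in> T i\<close>] by simp
        show "1 - indicator {- K<..K} t \<le> t\<^sup>2 / K\<^sup>2"
        proof (cases "t \<in> {- K<..K}")
          case False
          then have "\<bar>K\<bar> \<le> \<bar>t\<bar>" using K by auto
          then have "K\<^sup>2 \<le> t\<^sup>2" by (simp only: abs_le_square_iff)
          then show ?thesis using False K by (simp add: divide_simps)
        qed simp
      qed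
      also have "\<dots> = (\<Sum>t\<in>T i. p i t * t\<^sup>2) / K\<^sup>2" by (simp add: sum_divide_distrib)
      also have "\<dots> \<le> B / K\<^sup>2" using B(2)[of i] by (intro divide_right_mono) auto
      finally show ?thesis using \<open>B / K\<^sup>2 < \<epsilon>\<close> by linarith
    qed
    then show "\<exists>a b. a < b \<and> (\<forall>i. 1 - \<epsilon> < measure (M i) {a<..b})"
      using K by (intro exI[of _ "- K"] exI[of _ K]) auto
  qed
  then obtain r \<rho> where r: "strict_mono r" and \<rho>: "real_distribution \<rho>" and wc: "weak_conv_m (M \<circ> id \<circ> r) \<rho>"
    using tight_imp_convergent_subsubsequence[of M id] by (auto simp: strict_mono_id)
  interpret real_distribution \<rho> by fact
  have wcE: "(\<lambda>i. integral\<^sup>L (M (r i)) f) \<longlonglongrightarrow> integral\<^sup>L \<rho> f"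
    if "\<And>x. isCont f x" "\<And>x. norm (f x) \<le> B" for f :: "real \<Rightarrow> 'b::{banach, second_countable_topology}" and B
    using weak_conv_imp_integral_bdd_continuous_conv[OF _ \<rho> wc that] M by (simp add: o_def)
  show ?thesis
  proof (rule that[OF \<rho>])
    fix z :: complex assume z: "Im z > 0"
    have nz: "z - of_real t \<noteq> 0" for t using z by auto
    have lim\<rho>: "(\<lambda>i. \<Sum>t\<in>T (r i). of_real (p (r i) t) / (z - of_real t)) \<longlonglongrightarrow> cauchy_transform \<rho> z"
    proof -
      have "(\<lambda>i. integral\<^sup>L (M (r i)) (\<lambda>t. 1 / (z - complex_of_real t))) \<longlonglongrightarrow> cauchy_transform \<rho> z"
        unfolding cauchy_transform_def
        by (rule wcE[OF _ norm_resolvent_le[OF z]]) (use nz in \<open>auto intro!: continuous_intros\<close>)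
      then show ?thesis by (simp add: EC)
    qed
    have lim\<mu>: "(\<lambda>i. GS (r i) z) \<longlonglongrightarrow> cauchy_transform \<mu> z"
      using LIMSEQ_subseq_LIMSEQ[OF G\<mu>[OF z] r] by (simp add: o_def GS_def)
    \<comment> \<open>The product form passes to the limit without dividing by transforms that might
      vanish.\<close>
    have "(\<lambda>i. (\<Sum>t\<in>T (r i). of_real (p (r i) t) / (z - of_real t)) *
        (of_nat n - of_real (real n - 1) * (z * GS (r i) z)))
       \<longlonglongrightarrow> cauchy_transform \<rho> z * (of_nat n - of_real (real n - 1) * (z * cauchy_transform \<mu> z))"
      by (intro tendsto_intros lim\<rho> lim\<mu>)
    moreover have "(\<Sum>t\<in>T (r i). of_real (p (r i) t) / (z - of_real t)) *
        (of_nat n - of_real (real n - 1) * (z * GS (r i) z)) = GS (r i) z" for i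
      by (rule GT) (use z in auto)
    ultimately have "(\<lambda>i. GS (r i) z)
       \<longlonglongrightarrow> cauchy_transform \<rho> z * (of_nat n - of_real (real n - 1) * (z * cauchy_transform \<mu> z))"
      by simp
    then have "cauchy_transform \<rho> z * (of_nat n - of_real (real n - 1) * (z * cauchy_transform \<mu> z)) = cauchy_transform \<mu> z"
      using lim\<mu> by (rule LIMSEQ_unique)
    then show "recip_cauchy \<rho> z = n * recip_cauchy \<mu> z - (real n - 1) * z"
      using cauchy_transform_nonzero[OF \<mu> z] cauchy_transform_nonzero[OF \<rho> z]
      by (simp add: recip_cauchy_def field_simps)
  next
    fix q :: "nat \<Rightarrow> real" and \<delta> :: real
    assume q: "\<And>t. 0 \<le> (\<Sum>k\<le>6. q k * t ^ k)" and \<delta>: "0 < \<delta>"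
    define f where "f t = (\<Sum>k\<le>6. q k * t ^ k)" for t
    have f0: "0 \<le> f t" for t using q by (simp add: f_def)
    have [measurable]: "f \<in> borel_measurable borel" unfolding f_def by measurable
    \<comment> \<open>Truncation at \<open>\<delta>\<close> gives a bounded continuous test
      function. It dominates \<open>\<delta>\<close> times the indicator of the event, and it stays
      below \<open>f\<close>, whose means under the approximants are combinations of
      moments.\<close>
    have cont: "isCont (\<lambda>t. min (f t) \<delta>) t" for t
      unfolding f_def by (intro continuous_intros)
    have bd: "norm (min (f t) \<delta>) \<le> \<delta>" for t using f0[of t] \<delta> by auto
    have "\<delta> * measure \<rho> {t. \<delta> \<le> f t} = (\<integral>t. \<delta> * indicator {t. \<delta> \<le> f t} t \<partial>\<rho>)"
      by simp
    also have "\<dots> \<le> (\<integral>t. min (f t) \<delta> \<partial>\<rho>)"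
    proof (rule integral_mono)
      show "integrable \<rho> (\<lambda>t. \<delta> * indicator {t. \<delta> \<le> f t} t)"
        by (rule integrable_const_bound[where B = \<delta>]) (use \<delta> in \<open>auto split: split_indicator\<close>)
      show "integrable \<rho> (\<lambda>t. min (f t) \<delta>)"
        by (rule integrable_const_bound[where B = \<delta>]) (use bd in auto)
      show "\<delta> * indicator {t. \<delta> \<le> f t} t \<le> min (f t) \<delta>" for t
        using f0[of t] \<delta> by (auto split: split_indicator)
    qed
    also have "\<dots> \<le> (\<Sum>k\<le>6. q k * bool_moment n (\<lambda>k. moment k \<mu>) k)"
    proof (rule LIMSEQ_le[OF wcE[OF cont bd]])
      have "(\<lambda>i. \<Sum>k\<le>6. q k * (\<Sum>t\<in>T (r i). p (r i) t * t ^ k))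
         \<longlonglongrightarrow> (\<Sum>k\<le>6. q k * bool_moment n (\<lambda>k. moment k \<mu>) k)"
        by (intro tendsto_intros) (use LIMSEQ_subseq_LIMSEQ[OF limT r] in \<open>auto simp: o_def\<close>)
      then show "(\<lambda>i. \<Sum>t\<in>T (r i). p (r i) t * f t) \<longlonglongrightarrow> (\<Sum>k\<le>6. q k * bool_moment n (\<lambda>k. moment k \<mu>) k)"
        unfolding f_def sum_distrib_left
        by (subst sum.swap) (simp add: mult_ac)
      show "\<exists>N. \<forall>i\<ge>N. integral\<^sup>L (M (r i)) (\<lambda>t. min (f t) \<delta>) \<le> (\<Sum>t\<in>T (r i). p (r i) t * f t)"
        by (auto simp: ER intro!: sum_mono mult_left_mono less_imp_le[OF T(2)])
    qed
    finally show "\<delta> * measure \<rho> {t. \<delta> \<le> (\<Sum>k\<le>6. q k * t ^ k)} \<le> (\<Sum>k\<le>6. q k * bool_moment n (\<lambda>k. moment k \<mu>) k)"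
      by (simp add: f_def)
  qed
qed

text \<open>\<open>boolean_conv\<close> is a definite description, so each step of the induction
  needs a witness and its uniqueness. The witness is the next power from
  \<open>boolean_power_exists\<close>; uniqueness is \<open>cauchy_transform_inject\<close>.\<close>

lemma boolean_pow_unique:
  assumes \<mu>: "real_distribution \<mu>" and int6: "integrable \<mu> (\<lambda>t. t ^ 6)" and n: "n \<ge> 1"
    and \<rho>: "real_distribution \<rho>"
    and F: "\<And>z::complex. Im z > 0 \<Longrightarrow> recip_cauchy \<rho> z = n * recip_cauchy \<mu> z - (real n - 1) * z"
  shows "boolean_pow \<mu> n = \<rho>"
proof -
  have inject: "M = N" if "real_distribution M" "real_distribution N"
    "\<And>z::complex. Im z > 0 \<Longrightarrow> recip_cauchy M z = recip_cauchy N z" for M N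
    using that by (intro cauchy_transform_inject) (auto simp: recip_cauchy_def)
  have ex: "\<exists>M. real_distribution M \<and> (\<forall>z::complex. Im z > 0 \<longrightarrow> recip_cauchy M z = m * recip_cauchy \<mu> z - (real m - 1) * z)"
    if m: "m \<ge> 1" for m :: nat
    by (rule boolean_power_exists[OF \<mu> int6 m]) blast
  have "real_distribution (boolean_pow \<mu> (Suc m)) \<and>
     (\<forall>z::complex. Im z > 0 \<longrightarrow> recip_cauchy (boolean_pow \<mu> (Suc m)) z = Suc m * recip_cauchy \<mu> z - (real (Suc m) - 1) * z)" for m
  proof (induction m)
    case 0
    then show ?case using \<mu> by simp
  next
    case (Suc m)
    obtain M where M: "real_distribution M"
      "\<And>z::complex. Im z > 0 \<Longrightarrow> recip_cauchy M z = Suc (Suc m) * recip_cauchy \<mu> z - (real (Suc (Suc m)) - 1) * z"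
      using ex[of "Suc (Suc m)"] by auto
    have FM: "recip_cauchy M z = recip_cauchy (boolean_pow \<mu> (Suc m)) z + recip_cauchy \<mu> z - z" if "Im z > 0" for z
    proof -
      have "recip_cauchy (boolean_pow \<mu> (Suc m)) z = Suc m * recip_cauchy \<mu> z - (real (Suc m) - 1) * z"
        using Suc that by blast
      then show ?thesis unfolding M(2)[OF that] by (simp add: algebra_simps)
    qed
    have "boolean_pow \<mu> (Suc (Suc m)) = M"
      unfolding boolean_pow.simps boolean_conv_def
      by (rule the_equality) (use M(1) FM in \<open>auto intro: inject\<close>)
    then show ?case using M by blast
  qed
  from this[of "n - 1"] have "real_distribution (boolean_pow \<mu> n)"
    "\<And>z::complex. Im z > 0 \<Longrightarrow> recip_cauchy (boolean_pow \<mu> n) z = n * recip_cauchy \<mu> z - (real n - 1) * z"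
    using n by simp_all
  then show ?thesis using \<rho> F by (intro inject) auto
qed

lemma boolean_pow_markov:
  fixes \<mu> :: "real measure" and n :: nat
  assumes \<mu>: "real_distribution \<mu>" and int6: "integrable \<mu> (\<lambda>t. t ^ 6)" and n: "n \<ge> 1"
  shows "real_distribution (boolean_pow \<mu> n)"
    and "(\<And>t. 0 \<le> (\<Sum>k\<le>6. q k * t ^ k)) \<Longrightarrow> 0 < \<delta> \<Longrightarrow>
       \<delta> * measure (boolean_pow \<mu> n) {t. \<delta> \<le> (\<Sum>k\<le>6. q k * t ^ k)}
         \<le> (\<Sum>k\<le>6. q k * bool_moment n (\<lambda>k. moment k \<mu>) k)"
proof -
  obtain M where M: "real_distribution M" and
    F: "\<And>z::complex. Im z > 0 \<Longrightarrow> recip_cauchy M z = n * recip_cauchy \<mu> z - (real n - 1) * z" and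
    mk: "\<And>q \<delta>. (\<And>t. 0 \<le> (\<Sum>k\<le>6. q k * t ^ k)) \<Longrightarrow> 0 < \<delta> \<Longrightarrow>
       \<delta> * measure M {t. \<delta> \<le> (\<Sum>k\<le>6. q k * t ^ k)} \<le> (\<Sum>k\<le>6. q k * bool_moment n (\<lambda>k. moment k \<mu>) k)"
    by (rule boolean_power_exists[OF \<mu> int6 n]) blast
  have "boolean_pow \<mu> n = M" by (rule boolean_pow_unique[OF \<mu> int6 n M F])
  then show "real_distribution (boolean_pow \<mu> n)"
    and "(\<And>t. 0 \<le> (\<Sum>k\<le>6. q k * t ^ k)) \<Longrightarrow> 0 < \<delta> \<Longrightarrow>
       \<delta> * measure (boolean_pow \<mu> n) {t. \<delta> \<le> (\<Sum>k\<le>6. q k * t ^ k)}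
         \<le> (\<Sum>k\<le>6. q k * bool_moment n (\<lambda>k. moment k \<mu>) k)"
    using M mk by auto
qed

section \<open>Distance to the Bernoulli law\<close>

lemma cdf_of_sym_bernoulli:
  "cdf_of sym_bernoulli x = (if x < -1 then 0 else if x < 1 then 1 / 2 else 1)"
proof -
  have "cdf_of sym_bernoulli x = measure_pmf.prob (pmf_of_set {-1, 1}) {..x}"
    unfolding cdf_of_def sym_bernoulli_def by (subst measure_distr) auto
  also have "\<dots> = card ({-1, 1} \<inter> {..x}) / 2"
    by (subst measure_pmf_of_set) auto
  also have "{-1, 1} \<inter> {..x} = (if x < -1 then {} else if x < 1 then {-1} else {-1, 1})"
    by auto
  finally show ?thesis by auto
qed

text \<open>Upper bounds on the two neighbourhoods suffice: between the atoms the distribution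
  function is at most the bad mass plus the left one, and its complement at most the bad mass plus
  the right one. The shift by \<open>e + D\<close> clears the neighbourhoods, and the vertical slack
  \<open>e + D\<close> absorbs the errors.\<close>

lemma levy_dist_sym_bernoulli_le:
  assumes \<nu>: "real_distribution \<nu>" and e: "0 < e" and D: "0 \<le> D"
    and bad: "measure \<nu> {x. \<not> (\<bar>x - 1\<bar> \<le> e \<or> \<bar>x + 1\<bar> \<le> e)} \<le> D"
    and right: "measure \<nu> {x. \<bar>x - 1\<bar> \<le> e} \<le> 1 / 2 + e"
    and left: "measure \<nu> {x. \<bar>x + 1\<bar> \<le> e} \<le> 1 / 2 + e"
  shows "levy_dist \<nu> sym_bernoulli \<le> e + D"
proof -
  interpret real_distribution \<nu> by fact
  define X where "X = {x. \<not> (\<bar>x - 1\<bar> \<le> e \<or> \<bar>x + 1\<bar> \<le> e)}"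
  define R where "R = {x::real. \<bar>x - 1\<bar> \<le> e}"
  define L where "L = {x::real. \<bar>x + 1\<bar> \<le> e}"
  have [measurable]: "X \<in> sets borel" "R \<in> sets borel" "L \<in> sets borel"
    unfolding X_def R_def L_def by measurable
  note bds = bad[folded X_def] right[folded R_def] left[folded L_def]
  define H where "H = cdf_of \<nu>"
  have H: "0 \<le> H x" "H x \<le> 1" for x by (auto simp: H_def cdf_of_def)
  have HX: "H x \<le> D" if "x < -1 - e" for x
  proof -
    have "H x \<le> measure \<nu> X"
      unfolding H_def cdf_of_def using that e by (intro finite_measure_mono) (auto simp: X_def)
    then show ?thesis using bds by simp
  qed
  have HXL: "H x \<le> D + (1 / 2 + e)" if "x < 1 - e" for x
  proof -
    have "H x \<le> measure \<nu> (X \<union> L)"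
      unfolding H_def cdf_of_def using that e by (intro finite_measure_mono) (auto simp: X_def L_def)
    also have "\<dots> \<le> measure \<nu> X + measure \<nu> L" by (rule measure_Un_le) auto
    finally show ?thesis using bds by simp
  qed
  have compl: "1 - H x \<le> measure \<nu> A" if "\<And>t. t > x \<Longrightarrow> t \<in> A" "A \<in> sets borel" for x A
  proof -
    have "1 - H x = measure \<nu> (space \<nu> - {..x})"
      unfolding H_def cdf_of_def by (subst prob_compl) auto
    also have "\<dots> \<le> measure \<nu> A"
    proof (intro finite_measure_mono subsetI)
      fix t assume "t \<in> space \<nu> - {..x}"
      then show "t \<in> A" by (intro that(1)) auto
    qed (use that in simp)
    finally show ?thesis .
  qed
  have H1: "1 - D \<le> H x" if "1 + e \<le> x" for x
    using compl[of x X] that e bds by (force simp: X_def)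
  have H2: "1 / 2 - e - D \<le> H x" if "-1 + e \<le> x" for x
  proof -
    have "1 - H x \<le> measure \<nu> (X \<union> R)"
      by (rule compl) (use that e in \<open>auto simp: X_def R_def\<close>)
    also have "\<dots> \<le> measure \<nu> X + measure \<nu> R" by (rule measure_Un_le) auto
    finally show ?thesis using bds by simp
  qed
  have "H (x - (e + D)) - (e + D) \<le> cdf_of sym_bernoulli x \<and> cdf_of sym_bernoulli x \<le> H (x + (e + D)) + (e + D)" for x
  proof (cases "x < -1")
    case True
    then show ?thesis
      using HX[of "x - (e + D)"] H[of "x + (e + D)"] e D by (auto simp: cdf_of_sym_bernoulli)
  next
    case False
    show ?thesis
    proof (cases "x < 1")
      case True
      then show ?thesis
        using False HXL[of "x - (e + D)"] H2[of "x + (e + D)"] e D by (auto simp: cdf_of_sym_bernoulli)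
    next
      case False
      then show ?thesis
        using H(2)[of "x - (e + D)"] H1[of "x + (e + D)"] e D by (auto simp: cdf_of_sym_bernoulli)
    qed
  qed
  then show ?thesis
    unfolding levy_dist_def H_def using e D
    by (intro cInf_lower) (auto intro!: bdd_belowI[of _ 0])
qed

section \<open>Moments up to order six and elementary estimates\<close>

lemma bool_moment_values:
  assumes "a 0 = 1" "a 1 = 0" "a 2 = 1"
  shows "bool_moment n a 1 = 0" "bool_moment n a 2 = real n" "bool_moment n a 3 = real n * a 3"
    "bool_moment n a 4 = real n * a 4 + real n * (real n - 1)"
    "bool_moment n a 5 = real n * a 5 + 2 * real n * (real n - 1) * a 3"
    "bool_moment n a 6 = real n * a 6 + (real n - 1) * (2 * real n * a 4 + real n * (real n - 1) + real n * (a 3)\<^sup>2)"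
proof -
  show 1: "bool_moment n a 1 = 0"
    using assms by (subst bool_moment.simps) simp
  show 2: "bool_moment n a 2 = real n"
    using assms by (subst bool_moment.simps) (simp add: 1[unfolded One_nat_def] lessThan_nat_numeral lessThan_Suc numeral_2_eq_2[symmetric])
  show 3: "bool_moment n a 3 = real n * a 3"
    using assms by (subst bool_moment.simps) (simp add: 1[unfolded One_nat_def] 2 lessThan_nat_numeral lessThan_Suc numeral_2_eq_2[symmetric] algebra_simps)
  show 4: "bool_moment n a 4 = real n * a 4 + real n * (real n - 1)"
    using assms by (subst bool_moment.simps) (simp add: 1[unfolded One_nat_def] 2 3 lessThan_nat_numeral lessThan_Suc numeral_2_eq_2[symmetric] algebra_simps)
  show 5: "bool_moment n a 5 = real n * a 5 + 2 * real n * (real n - 1) * a 3"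
    using assms by (subst bool_moment.simps) (simp add: 1[unfolded One_nat_def] 2 3 4 lessThan_nat_numeral lessThan_Suc numeral_2_eq_2[symmetric] algebra_simps)
  show "bool_moment n a 6 = real n * a 6 + (real n - 1) * (2 * real n * a 4 + real n * (real n - 1) + real n * (a 3)\<^sup>2)"
    using assms by (subst bool_moment.simps) (simp add: 1[unfolded One_nat_def] 2 3 4 5 lessThan_nat_numeral lessThan_Suc numeral_2_eq_2[symmetric] algebra_simps power2_eq_square)
qed

lemma sum_atMost_6: "(\<Sum>k\<le>6. f k) = f 0 + f 1 + f 2 + f 3 + f 4 + f 5 + f (6::nat)"
  by (simp add: atMost_nat_numeral atMost_Suc add_ac)

text \<open>The first bound keeps \<open>x\<close> away from 0, so the factor \<open>x^2\<close> can
  be divided out of the second; this leaves \<open>x^2 - 1 = g + c / s * x\<close> with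
  \<open>\<bar>g\<bar> < 1 / s\<close>. Dividing by \<open>\<bar>x\<bar> + 1\<close> gives the
  claim. The threshold \<open>9 / 16\<close> is the square of \<open>3 / 4\<close>, chosen so that
  \<open>x^2 > 1 / 4\<close> matches the 4 in the second bound.\<close>

lemma near_pm_one:
  fixes x s c :: real
  assumes s: "s > 0" and f1: "(x\<^sup>2 - 1)\<^sup>2 < 9 / 16"
    and f2: "x\<^sup>2 * (x\<^sup>2 - 1 - c / s * x)\<^sup>2 < 1 / (4 * s\<^sup>2)"
  shows "\<bar>\<bar>x\<bar> - 1\<bar> \<le> (\<bar>c\<bar> + 1) / s"
proof -
  define g where "g = x\<^sup>2 - 1 - c / s * x"
  have "(x\<^sup>2 - 1)\<^sup>2 < (3 / 4)\<^sup>2" using f1 by (simp add: power2_eq_square)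
  then have "\<bar>x\<^sup>2 - 1\<bar> < 3 / 4" by (rule power2_less_imp_less[of "\<bar>x\<^sup>2 - 1\<bar>", unfolded power2_abs]) simp
  then have x: "1 / 4 < x\<^sup>2" by linarith
  have "1 / 4 * g\<^sup>2 \<le> x\<^sup>2 * g\<^sup>2" using x by (intro mult_right_mono) auto
  then have "g\<^sup>2 < (1 / s)\<^sup>2" using f2 by (simp add: g_def power_divide)
  then have g: "\<bar>g\<bar> < 1 / s" by (rule power2_less_imp_less[of "\<bar>g\<bar>", unfolded power2_abs]) (use s in simp)
  have "\<bar>\<bar>x\<bar> - 1\<bar> * (\<bar>x\<bar> + 1) = \<bar>x\<^sup>2 - 1\<bar>"
  proof -
    have "x\<^sup>2 - 1 = (\<bar>x\<bar> - 1) * (\<bar>x\<bar> + 1)" by (simp add: algebra_simps power2_eq_square)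
    then show ?thesis by (simp only: abs_mult)
  qed
  also have "\<dots> \<le> \<bar>g\<bar> + \<bar>c / s * x\<bar>" using abs_triangle_ineq[of g "c / s * x"] by (simp add: g_def)
  also have "\<dots> \<le> 1 / s + \<bar>c\<bar> / s * \<bar>x\<bar>" using g s by (simp add: abs_mult)
  also have "\<dots> \<le> (\<bar>c\<bar> + 1) / s * (\<bar>x\<bar> + 1)"
    using s by (simp add: field_simps)
  finally show ?thesis by (rule mult_right_le_imp_le) simp
qed

text \<open>Twice the difference of \<open>(1 / 2 + e) * (2 - e)^2\<close> and 2 is
  \<open>e * (4 - 7 * e + 2 * e^2)\<close>. It converts Markov's bound for the squares of
  \<open>x + 1\<close> and \<open>x - 1\<close> into the required \<open>1 / 2 + e\<close>.\<close>

lemma two_div_square_le: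
  fixes e :: real
  assumes "0 < e" "e \<le> 1 / 2"
  shows "2 / (2 - e)\<^sup>2 \<le> 1 / 2 + e"
proof -
  have "0 \<le> e * (4 - 7 * e + 2 * e\<^sup>2)"
    using assms by (intro mult_nonneg_nonneg) auto
  then have "2 \<le> (1 / 2 + e) * (2 - e)\<^sup>2"
    by (simp add: power2_eq_square algebra_simps)
  then show ?thesis using assms by (simp add: divide_simps)
qed

theorem theorem1:
  fixes \<mu> :: "real measure"
  assumes "real_distribution \<mu>"
    and "integrable \<mu> (\<lambda>t. t ^ 6)"
    and "moment 1 \<mu> = 0"
    and "moment 2 \<mu> = 1"
  shows "\<exists>C::real. \<exists>N::nat. \<forall>n\<ge>N. n \<ge> 1 \<longrightarrow>
           levy_dist (dilation (1 / sqrt (real n)) (boolean_pow \<mu> n)) sym_bernoulli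
             \<le> 7 / 2 * ((C + 2) / sqrt (real n))"
proof -
  interpret real_distribution \<mu> by fact
  define a where "a k = moment k \<mu>" for k
  \<comment> \<open>\<open>A / n\<close> and \<open>B / n^2\<close> bound the means of
    \<open>f1\<close> and \<open>f2\<close> below, \<open>E / sqrt n\<close> is the radius from
    \<open>near_pm_one\<close> with \<open>c = a 3\<close>, and \<open>D / n\<close> bounds the mass
    outside both neighbourhoods.\<close>
  define A where "A = \<bar>a 4 - 1\<bar>"
  define B where "B = \<bar>a 6 - 2 * a 3 * a 5 + (a 3)\<^sup>2 * a 4 - 2 * a 4 + 2 * (a 3)\<^sup>2 + 1\<bar>"
  define E where "E = \<bar>a 3\<bar> + 1"
  define D where "D = 2 * A + 4 * B"
  have a: "a 0 = 1" "a 1 = 0" "a 2 = 1"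
    using assms(3,4) prob_space by (auto simp: a_def moment_def)
  note bm = bool_moment_values[of a, OF a]
  have E: "E > 0" by (simp add: E_def)
  have D: "0 \<le> D" by (simp add: D_def A_def B_def)
  have main: "levy_dist (dilation (1 / sqrt (real n)) (boolean_pow \<mu> n)) sym_bernoulli \<le> (E + D) / sqrt (real n)"
    if nN: "n \<ge> nat \<lceil>4 * E\<^sup>2\<rceil>" and n: "n \<ge> 1" for n
  proof -
    define s where "s = sqrt (real n)"
    have s: "s \<ge> 1" "s\<^sup>2 = real n" using n by (auto simp: s_def)
    define \<rho> where "\<rho> = boolean_pow \<mu> n"
    define \<nu> where "\<nu> = dilation (1 / s) \<rho>"
    have \<rho>: "real_distribution \<rho>"
      unfolding \<rho>_def by (rule boolean_pow_markov(1)[OF assms(1,2) n])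
    interpret \<rho>: real_distribution \<rho> by fact
    have \<nu>: "real_distribution \<nu>"
      unfolding \<nu>_def dilation_def by (rule \<rho>.real_distribution_distr) simp
    interpret \<nu>: real_distribution \<nu> by fact
    define u where "u = 1 / s"
    have us: "u * s = 1" using s(1) by (simp add: u_def)
    have un: "u\<^sup>2 * real n = 1"
      unfolding s(2)[symmetric] using us by (simp flip: power_mult_distrib)
    \<comment> \<open>Moments rescaled to the dilated law. The closed forms come from pairing
      factors \<open>n\<close> with \<open>u^2\<close>, whose product is 1.\<close>
    define h where "h k = bool_moment n a k * u ^ k" for k
    have h: "h 0 = 1" "h 1 = 0" "h 2 = 1" "h 3 = a 3 * u" "h 4 = 1 + (a 4 - 1) * u\<^sup>2"
      "h 5 = 2 * a 3 * u + (a 5 - 2 * a 3) * u ^ 3"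
      "h 6 = a 6 * u ^ 4 + (1 - u\<^sup>2) * (2 * a 4 * u\<^sup>2 + 1 - u\<^sup>2 + (a 3)\<^sup>2 * u\<^sup>2)"
    proof -
      show "h 0 = 1" "h 1 = 0" using bm(1) a by (simp_all add: h_def)
      show "h 2 = 1" unfolding h_def bm using un by (simp add: mult.commute)
      have "h 3 = a 3 * u * (u\<^sup>2 * n)"
        unfolding h_def bm by (simp add: algebra_simps power2_eq_square power3_eq_cube)
      then show "h 3 = a 3 * u" by (simp add: un)
      have "h 4 = (u\<^sup>2 * n) * (a 4 * u\<^sup>2 + (u\<^sup>2 * n) - u\<^sup>2)"
        unfolding h_def bm by (simp add: algebra_simps power2_eq_square power4_eq_xxxx)
      then show "h 4 = 1 + (a 4 - 1) * u\<^sup>2" unfolding un by (simp add: algebra_simps)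
      have "h 5 = (u\<^sup>2 * n) * (a 5 * u ^ 3 + 2 * u * ((u\<^sup>2 * n) - u\<^sup>2) * a 3)"
        unfolding h_def bm by (simp add: algebra_simps eval_nat_numeral)
      then show "h 5 = 2 * a 3 * u + (a 5 - 2 * a 3) * u ^ 3"
        unfolding un by (simp add: algebra_simps power2_eq_square power3_eq_cube)
      have "h 6 = (u\<^sup>2 * n) * (a 6 * u ^ 4 + ((u\<^sup>2 * n) - u\<^sup>2) * (2 * a 4 * u\<^sup>2 + (u\<^sup>2 * n) - u\<^sup>2 + (a 3)\<^sup>2 * u\<^sup>2))"
        unfolding h_def bm by (simp add: algebra_simps eval_nat_numeral)
      then show "h 6 = a 6 * u ^ 4 + (1 - u\<^sup>2) * (2 * a 4 * u\<^sup>2 + 1 - u\<^sup>2 + (a 3)\<^sup>2 * u\<^sup>2)"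
        unfolding un by simp
    qed
    have markov: "\<delta> * measure \<nu> {x. \<delta> \<le> f x} \<le> (\<Sum>k\<le>6. d k * h k)"
      if f: "f = (\<lambda>x. \<Sum>k\<le>6. d k * x ^ k)" "\<And>x. 0 \<le> f x" and \<delta>: "0 < \<delta>"
      for f d \<delta>
    proof -
      have [measurable]: "f \<in> borel_measurable borel" unfolding f(1) by measurable
      have fu: "f (u * t) = (\<Sum>k\<le>6. d k * u ^ k * t ^ k)" for t
        unfolding f(1) by (simp add: power_mult_distrib mult_ac)
      have "\<delta> * measure \<nu> {x. \<delta> \<le> f x} = \<delta> * measure \<rho> {t. \<delta> \<le> (\<Sum>k\<le>6. d k * u ^ k * t ^ k)}"
        unfolding \<nu>_def dilation_def u_def[symmetric]
        by (subst measure_distr) (auto simp: vimage_def fu)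
      also have "\<dots> \<le> (\<Sum>k\<le>6. d k * u ^ k * bool_moment n a k)"
        unfolding \<rho>_def a_def[abs_def]
      proof (rule boolean_pow_markov(2)[OF assms(1,2) n _ \<delta>])
        show "0 \<le> (\<Sum>k\<le>6. d k * u ^ k * t ^ k)" for t using f(2)[of "u * t"] unfolding fu .
      qed
      finally show ?thesis by (simp add: h_def mult_ac)
    qed
    define e where "e = E / s"
    have e0: "0 < e" using E s by (simp add: e_def)
    \<comment> \<open>The lower bound \<open>4 * E^2\<close> on \<open>n\<close> is chosen for this,
      the range of \<open>two_div_square_le\<close>.\<close>
    have e2: "e \<le> 1 / 2"
    proof -
      have "4 * E\<^sup>2 \<le> real n" using nN by linarith
      then have "(2 * E)\<^sup>2 \<le> s\<^sup>2" by (simp add: s(2) power_mult_distrib)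
      then have "2 * E \<le> s" by (rule power2_le_imp_le) (use s(1) in simp)
      then show ?thesis using s(1) by (simp add: e_def field_simps)
    qed
    \<comment> \<open>The mean of f1 is only of order 1/n because of the mass near 0. The factor \<open>x\<^sup>2\<close> in f2
      suppresses this mass and the term \<open>a 3 / s * x\<close> removes the common shift of the two atoms,
      which leaves a mean of order \<open>1/n\<^sup>2\<close>.\<close>
    define f1 where "f1 x = (x\<^sup>2 - 1)\<^sup>2" for x :: real
    define f2 where "f2 x = x\<^sup>2 * (x\<^sup>2 - 1 - a 3 / s * x)\<^sup>2" for x :: real
    have m1: "9 / 16 * measure \<nu> {x. 9 / 16 \<le> f1 x} \<le> A / n"
    proof -
      define d where "d = (\<lambda>_::nat. 0 :: real)(0 := 1, 2 := - 2, 4 := 1)"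
      have "9 / 16 * measure \<nu> {x. 9 / 16 \<le> f1 x} \<le> (\<Sum>k\<le>6. d k * h k)"
      proof (rule markov)
        show "f1 = (\<lambda>x. \<Sum>k\<le>6. d k * x ^ k)"
          by (rule ext) (simp add: sum_atMost_6 d_def f1_def power2_eq_square power4_eq_xxxx algebra_simps)
      qed (auto simp: f1_def)
      also have "\<dots> = (a 4 - 1) * u\<^sup>2"
        by (simp add: sum_atMost_6 d_def h)
      also have "\<dots> = (a 4 - 1) / n"
        using s(1) by (simp add: u_def power_divide s(2))
      also have "\<dots> \<le> A / n" by (intro divide_right_mono) (auto simp: A_def)
      finally show ?thesis .
    qed
    have m2: "1 / (4 * s\<^sup>2) * measure \<nu> {x. 1 / (4 * s\<^sup>2) \<le> f2 x} \<le> B / n\<^sup>2"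
    proof -
      define b where "b = a 3 * u"
      define d where "d = (\<lambda>_::nat. 0 :: real)(2 := 1, 3 := 2 * b, 4 := b\<^sup>2 - 2, 5 := - 2 * b, 6 := 1)"
      have "1 / (4 * s\<^sup>2) * measure \<nu> {x. 1 / (4 * s\<^sup>2) \<le> f2 x} \<le> (\<Sum>k\<le>6. d k * h k)"
      proof (rule markov)
        have "a 3 / s = b" by (simp add: b_def u_def)
        then show "f2 = (\<lambda>x. \<Sum>k\<le>6. d k * x ^ k)"
          by (intro ext) (simp add: sum_atMost_6 d_def f2_def eval_nat_numeral algebra_simps)
      qed (use n in \<open>auto simp: f2_def s(2)\<close>)
      \<comment> \<open>The constant terms and the coefficients of \<open>u^2\<close> cancel, the
        latter thanks to the choice \<open>b = a 3 * u\<close>; only a multiple of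
        \<open>u ^ 4\<close> remains.\<close>
      also have "\<dots> = (a 6 - 2 * a 3 * a 5 + (a 3)\<^sup>2 * a 4 - 2 * a 4 + 2 * (a 3)\<^sup>2 + 1) * u ^ 4"
        by (simp add: sum_atMost_6 d_def h b_def) (simp add: algebra_simps eval_nat_numeral)
      also have "u ^ 4 = 1 / n\<^sup>2"
      proof -
        have "u ^ 4 = (u\<^sup>2)\<^sup>2" by simp
        also have "u\<^sup>2 = 1 / n" by (simp add: u_def power_divide s(2))
        finally show ?thesis by (simp add: power_divide)
      qed
      also have "(a 6 - 2 * a 3 * a 5 + (a 3)\<^sup>2 * a 4 - 2 * a 4 + 2 * (a 3)\<^sup>2 + 1) * (1 / n\<^sup>2) \<le> B * (1 / n\<^sup>2)"
        by (intro mult_right_mono) (auto simp: B_def)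
      finally show ?thesis by simp
    qed
    \<comment> \<open>Balances the two atoms: \<open>(x + \<sigma>)\<^sup>2\<close> has mean 2 and is close to 4 near \<open>\<sigma>\<close>.\<close>
    have m3: "(2 - e)\<^sup>2 * measure \<nu> {x. (2 - e)\<^sup>2 \<le> (x + \<sigma>)\<^sup>2} \<le> 2" if \<sigma>: "\<sigma> = 1 \<or> \<sigma> = -1" for \<sigma> :: real
    proof -
      define d where "d = (\<lambda>_::nat. 0 :: real)(0 := 1, 1 := 2 * \<sigma>, 2 := 1)"
      have "(2 - e)\<^sup>2 * measure \<nu> {x. (2 - e)\<^sup>2 \<le> (x + \<sigma>)\<^sup>2} \<le> (\<Sum>k\<le>6. d k * h k)"
      proof (rule markov)
        show "(\<lambda>x. (x + \<sigma>)\<^sup>2) = (\<lambda>x. \<Sum>k\<le>6. d k * x ^ k)"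
          using \<sigma> by (intro ext) (auto simp: sum_atMost_6 d_def power2_eq_square algebra_simps)
      qed (use e2 in auto)
      also have "\<dots> = 2" using h by (simp add: sum_atMost_6 d_def)
      finally show ?thesis .
    qed
    have near: "measure \<nu> {x. \<bar>x - \<sigma>\<bar> \<le> e} \<le> 1 / 2 + e" if \<sigma>: "\<sigma> = 1 \<or> \<sigma> = -1" for \<sigma> :: real
    proof -
      have "measure \<nu> {x. \<bar>x - \<sigma>\<bar> \<le> e} \<le> measure \<nu> {x. (2 - e)\<^sup>2 \<le> (x + \<sigma>)\<^sup>2}"
      proof (intro \<nu>.finite_measure_mono)
        show "{x. \<bar>x - \<sigma>\<bar> \<le> e} \<subseteq> {x. (2 - e)\<^sup>2 \<le> (x + \<sigma>)\<^sup>2}"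
        proof safe
          fix x assume "\<bar>x - \<sigma>\<bar> \<le> e"
          then have "\<bar>2 - e\<bar> \<le> \<bar>x + \<sigma>\<bar>" using \<sigma> e2 by auto
          then show "(2 - e)\<^sup>2 \<le> (x + \<sigma>)\<^sup>2" by (simp add: abs_le_square_iff)
        qed
      qed simp
      also have "\<dots> \<le> 2 / (2 - e)\<^sup>2"
        using m3[OF \<sigma>] e2 by (simp add: field_simps)
      also have "\<dots> \<le> 1 / 2 + e" by (rule two_div_square_le[OF e0 e2])
      finally show ?thesis .
    qed
    have bad: "measure \<nu> {x. \<not> (\<bar>x - 1\<bar> \<le> e \<or> \<bar>x + 1\<bar> \<le> e)} \<le> D / n"
    proof -
      have [measurable]: "f1 \<in> borel_measurable borel" "f2 \<in> borel_measurable borel"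
        unfolding f1_def f2_def by measurable
      have "measure \<nu> {x. \<not> (\<bar>x - 1\<bar> \<le> e \<or> \<bar>x + 1\<bar> \<le> e)}
          \<le> measure \<nu> ({x. 9 / 16 \<le> f1 x} \<union> {x. 1 / (4 * s\<^sup>2) \<le> f2 x})"
      proof (intro \<nu>.finite_measure_mono subsetI)
        fix x assume x: "x \<in> {x. \<not> (\<bar>x - 1\<bar> \<le> e \<or> \<bar>x + 1\<bar> \<le> e)}"
        show "x \<in> {x. 9 / 16 \<le> f1 x} \<union> {x. 1 / (4 * s\<^sup>2) \<le> f2 x}"
        proof (rule ccontr)
          assume "x \<notin> {x. 9 / 16 \<le> f1 x} \<union> {x. 1 / (4 * s\<^sup>2) \<le> f2 x}"
          then have "\<bar>\<bar>x\<bar> - 1\<bar> \<le> (\<bar>a 3\<bar> + 1) / s"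
            using s(1) by (intro near_pm_one) (auto simp: f1_def f2_def not_le)
          then show False using x by (auto simp: e_def E_def abs_if split: if_splits)
        qed
      qed simp
      also have "\<dots> \<le> measure \<nu> {x. 9 / 16 \<le> f1 x} + measure \<nu> {x. 1 / (4 * s\<^sup>2) \<le> f2 x}"
        by (rule measure_Un_le) auto
      \<comment> \<open>Dividing by the thresholds gives the factors \<open>16 / 9\<close>, rounded
        up to 2, and \<open>4 * n\<close>, which turns \<open>B / n^2\<close> into
        \<open>4 * B / n\<close>.\<close>
      also have "\<dots> \<le> 2 * A / n + 4 * B / n"
      proof (rule add_mono)
        have "0 \<le> A / n" by (simp add: A_def)
        then show "measure \<nu> {x. 9 / 16 \<le> f1 x} \<le> 2 * A / n" using m1 by simp
        show "measure \<nu> {x. 1 / (4 * s\<^sup>2) \<le> f2 x} \<le> 4 * B / n"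
          using m2 n unfolding s(2) by (simp add: field_simps power2_eq_square)
      qed
      finally show ?thesis by (simp add: D_def add_divide_distrib)
    qed
    have "levy_dist \<nu> sym_bernoulli \<le> e + D / n"
      by (rule levy_dist_sym_bernoulli_le[OF \<nu> e0 _ bad])
         (use near[of 1] near[of "-1"] D in auto)
    also have "D / n \<le> D / s"
    proof (rule divide_left_mono)
      show "s \<le> real n" using s(1) unfolding s(2)[symmetric] by (simp add: power2_eq_square)
    qed (use D s n in auto)
    finally show ?thesis by (simp add: \<nu>_def \<rho>_def s_def e_def add_divide_distrib)
  qed
  show ?thesis
  proof (intro exI allI impI)
    fix n :: nat assume "n \<ge> nat \<lceil>4 * E\<^sup>2\<rceil>" "n \<ge> 1"
    then have "levy_dist (dilation (1 / sqrt (real n)) (boolean_pow \<mu> n)) sym_bernoulli \<le> (E + D) / sqrt (real n)"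
      by (rule main)
    \<comment> \<open>The witness for \<open>C\<close> solves
      \<open>7 / 2 * (C + 2) = E + D\<close>; it depends on the moments of \<open>\<mu>\<close>
      alone.\<close>
    also have "\<dots> = 7 / 2 * ((2 / 7 * (E + D) - 2 + 2) / sqrt (real n))"
      using \<open>n \<ge> 1\<close> by (simp add: field_simps)
    finally show "levy_dist (dilation (1 / sqrt (real n)) (boolean_pow \<mu> n)) sym_bernoulli
       \<le> 7 / 2 * ((2 / 7 * (E + D) - 2 + 2) / sqrt (real n))" .
  qed
qed

end
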